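(* Let $N\ge 2$, let $A^{(n)}\in\mathbb{R}^{I_n\times R}$ ($n=1,\dots,N$), $T=\sum_n I_n$, $\mu>0$, and let $H=J^TJ\in\mathbb{R}^{RT\times RT}$ be the approximate Hessian of the rank-$R$ CP model at $(A^{(1)},\dots,A^{(N)})$ (see context), $H_\mu=H+\mu I_{RT}$. Put $C^{(n)}=A^{(n)T}A^{(n)}$, $\Gamma^{(n,m)}=\circledast_{k\neq n,m}C^{(k)}$, $\Gamma^{(n)}=\Gamma^{(n,n)}$, $\widetilde\Gamma^{(n)}_\mu=(\Gamma^{(n)}+\mu I_R)^{-1}$, let $K=[K^{(n,m)}]_{n,m=1}^N\in\mathbb{R}^{NR^2\times NR^2}$ with blocks $K^{(n,m)}=(1-\delta_{n,m})\,P_R\,\operatorname{diag}(\operatorname{vec}(\Gamma^{(n,m)}))\in\mathbb{R}^{R^2\times R^2}$, let $\Psi_\mu=\operatorname{blkdiag}(\widetilde\Gamma^{(n)}_\mu\otimes C^{(n)})_{n=1}^N$, and let $$B_\mu=\begin{cases}(K^{-1}+\Psi_\mu)^{-1}, & K\text{ invertible},\\ K\,(I_{NR^2}+\Psi_\mu K)^{-1}, & \text{otherwise},\end{cases}$$ with $R^2\times R^2$ blocks $B_\mu^{(n,m)}$, $n,m=1,\dots,N$. Then $H_\mu^{-1}=\widetilde H_\mu=[\widetilde H^{(n,m)}_\mu]_{n,m=1}^N$ is the $N\times N$ block matrix with blocks of size $RI_n\times RI_m$ given by $$\widetilde H^{(n,m)}_\mu=\delta_{n,m}\big(\widetilde\Gamma^{(n)}_\mu\otimes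 I_{I_n}\big)-\big(I_R\otimes A^{(n)}\big)\,\widetilde S^{(n,m)}_\mu\,\big(I_R\otimes A^{(m)T}\big),$$ where $$\widetilde S^{(n,m)}_\mu=\big(\widetilde\Gamma^{(n)}_\mu\otimes I_R\big)\,B^{(n,m)}_\mu\,\big(\widetilde\Gamma^{(m)}_\mu\otimes I_R\big)\in\mathbb{R}^{R^2\times R^2}.$$
   Context: Notation: $\otimes$ is the Kronecker product, $\circledast$ the Hadamard (entrywise) product; $\circledast_{k\ne n,m}$ is over all $k\in\{1,\dots,N\}\setminus\{n,m\}$, and an empty Hadamard product of $R\times R$ matrices is the all-ones matrix. $\delta_{n,m}$ is the Kronecker delta. $\operatorname{vec}$ of a matrix stacks its columns; $\operatorname{vec}$ of a tensor lists entries with the first index running fastest. $P_R$ is the $R^2\times R^2$ permutation matrix with $P_R\operatorname{vec}(X^T)=\operatorname{vec}(X)$ for every $R\times R$ matrix $X$. $\operatorname{blkdiag}(M_n)_{n=1}^N$ is the block diagonal matrix with diagonal blocks $M_1,\dots,M_N$. CP model: with $a^{(n)}_r$ the $r$-th column of $A^{(n)}$, $\widehat{\mathcal{Y}}=\sum_{r=1}^R a^{(1)}_r\circ\cdots\circ a^{(N)}_r\in\mathbb{R}^{I_1\times\cdots\times I_N}$ ($\circ$ the outer product). The parameter vector is $a=[\operatorname{vec}(A^{(1)})^T,\dots,\operatorname{vec}(A^{(N)})^T]^T\in\mathbb{R}^{RT}$, and $J\in\mathbb{R}^{(\prod_n I_n)\times RT}$ is the Jacobian of $\operatorname{vec}(\widehat{\mathcal{Y}})$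 with respect to $a$. *)

theory Defs
  imports
    "HOL-Analysis.Derivative"
    "Jordan_Normal_Form.Gauss_Jordan_Elimination"
begin

text \<open>
  All indices are 0-based: the modes are \<open>n < N\<close>, and \<open>A n\<close> is the factor matrix of mode \<open>n\<close>,
  of size \<open>I n\<close> times \<open>R\<close>.
\<close>

section \<open>Matrix operations\<close>

text \<open>Meaningful for invertible matrices only; see the lemma below.\<close>

definition mat_inv :: "'a::field mat \<Rightarrow> 'a mat" where
  "mat_inv M = the (mat_inverse M)"

lemma mat_inv:
  assumes "M \<in> carrier_mat n n" "invertible_mat M"
  shows "M * mat_inv M = 1\<^sub>m n" "mat_inv M * M = 1\<^sub>m n" "mat_inv M \<in> carrier_mat n n"
proof -
  obtain B where B: "inverts_mat M B" "inverts_mat B M"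
    using assms(2) by (auto simp: invertible_mat_def)
  have 1: "M * B = 1\<^sub>m n" using B(1) assms(1) by (simp add: inverts_mat_def)
  have 2: "B * M = 1\<^sub>m (dim_row B)" using B(2) by (simp add: inverts_mat_def)
  have "dim_row B = n" using arg_cong[OF 2, of dim_col] assms(1) by simp
  moreover have "dim_col B = n" using arg_cong[OF 1, of dim_col] assms(1) by simp
  ultimately have "B \<in> carrier_mat n n" and "B * M = 1\<^sub>m n" using 2 by auto
  then have "M \<in> Units (ring_mat TYPE('a) n ())"
    using 1 assms(1) by (auto simp: Units_def ring_mat_def)
  then obtain B' where "mat_inverse M = Some B'"
    using mat_inverse(1)[OF assms(1), where b = "()"] by (cases "mat_inverse M") auto
  then show "M * mat_inv M = 1\<^sub>m n" "mat_inv M * M = 1\<^sub>m n" "mat_inv M \<in> carrier_mat n n"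
    using mat_inverse(2)[OF assms(1)] by (auto simp: mat_inv_def)
qed

definition vec_of_mat :: "'a mat \<Rightarrow> 'a vec" where
  "vec_of_mat X = vec (dim_row X * dim_col X) (\<lambda>l. X $$ (l mod dim_row X, l div dim_row X))"

definition kronecker :: "'a::times mat \<Rightarrow> 'a mat \<Rightarrow> 'a mat" (infixl "\<otimes>\<^sub>k" 70) where
  "X \<otimes>\<^sub>k Y = mat (dim_row X * dim_row Y) (dim_col X * dim_col Y)
     (\<lambda>(i, j). X $$ (i div dim_row Y, j div dim_col Y) * Y $$ (i mod dim_row Y, j mod dim_col Y))"

text \<open>The empty Hadamard product is the all-ones matrix.\<close>

definition hadamard_prod :: "nat \<Rightarrow> 'k set \<Rightarrow> ('k \<Rightarrow> 'a::comm_monoid_mult mat) \<Rightarrow> 'a mat" where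
  "hadamard_prod R S M = mat R R (\<lambda>(i, j). \<Prod>k\<in>S. M k $$ (i, j))"

definition P_mat :: "nat \<Rightarrow> real mat" where
  "P_mat R = (THE P. P \<in> carrier_mat (R\<^sup>2) (R\<^sup>2) \<and>
     (\<forall>X \<in> carrier_mat R R. P *\<^sub>v vec_of_mat (X\<^sup>T) = vec_of_mat X))"

lemma P_mat_unique:
  fixes R
  defines "Q \<equiv> mat (R\<^sup>2) (R\<^sup>2)
    (\<lambda>(i, j). if i div R = j mod R \<and> i mod R = j div R then 1 else 0 :: real)"
  assumes P: "P \<in> carrier_mat (R\<^sup>2) (R\<^sup>2)"
    and PX: "\<forall>X \<in> carrier_mat R R. P *\<^sub>v vec_of_mat (X\<^sup>T) = vec_of_mat X"
  shows "P = Q"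
proof (rule eq_matI)
  fix i j assume "i < dim_row Q" "j < dim_col Q"
  then have i: "i < R * R" and j: "j < R * R" by (auto simp: Q_def power2_eq_square)
  have bnd: "j mod R < R" "j div R < R" "i mod R < R" "i div R < R"
    using i j by (cases R; auto simp: less_mult_imp_div_less)+
  define X where "X = mat R R (\<lambda>(p, q). if p = j div R \<and> q = j mod R then 1 else 0 :: real)"
  have X: "X \<in> carrier_mat R R" by (simp add: X_def)
  have "vec_of_mat (X\<^sup>T) = unit_vec (R\<^sup>2) j"
  proof (rule eq_vecI)
    fix l assume "l < dim_vec (unit_vec (R\<^sup>2) j :: real vec)"
    then have l: "l < R * R" by (simp add: power2_eq_square)
    then have "l mod R < R" "l div R < R"
      by (cases R; auto simp: less_mult_imp_div_less)+
    moreover have "(l div R = j div R \<and> l mod R = j mod R) = (l = j)"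
      by (metis div_mult_mod_eq)
    ultimately show "vec_of_mat (X\<^sup>T) $ l = unit_vec (R\<^sup>2) j $ l"
      using l j by (auto simp: vec_of_mat_def X_def power2_eq_square)
  qed (simp add: vec_of_mat_def X_def power2_eq_square)
  then have "P *\<^sub>v unit_vec (R\<^sup>2) j = vec_of_mat X" using PX X by auto
  then have "(P *\<^sub>v unit_vec (R\<^sup>2) j) $ i = vec_of_mat X $ i" by simp
  moreover have "(P *\<^sub>v unit_vec (R\<^sup>2) j) $ i = P $$ (i, j)"
    using P i j by (simp add: power2_eq_square)
  ultimately show "P $$ (i, j) = Q $$ (i, j)"
    using i j bnd by (auto simp: vec_of_mat_def X_def Q_def power2_eq_square)
qed (use P in \<open>auto simp: Q_def\<close>)

lemma P_mat_exists:
  fixes R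
  defines "Q \<equiv> mat (R\<^sup>2) (R\<^sup>2)
    (\<lambda>(i, j). if i div R = j mod R \<and> i mod R = j div R then 1 else 0 :: real)"
  assumes X: "X \<in> carrier_mat R R"
  shows "Q *\<^sub>v vec_of_mat (X\<^sup>T) = vec_of_mat X"
proof (rule eq_vecI)
  fix i assume "i < dim_vec (vec_of_mat X)"
  then have i: "i < R * R" using X by (simp add: vec_of_mat_def)
  then have R: "R > 0" by (cases R) auto
  have bnd: "i mod R < R" "i div R < R"
    using i R by (auto simp: less_mult_imp_div_less)
  define j0 where "j0 = (i mod R) * R + i div R"
  have d: "j0 div R = i mod R" "j0 mod R = i div R" using bnd by (auto simp: j0_def)
  have "(i mod R) * R + i div R < (i mod R + 1) * R" using bnd by simp
  also have "\<dots> \<le> R * R" using Suc_leI[OF bnd(1)] by (intro mult_right_mono) auto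
  finally have j0: "j0 < R * R" by (simp add: j0_def)
  have eq: "(i div R = j mod R \<and> i mod R = j div R) = (j = j0)" for j
    using d by (metis div_mult_mod_eq)
  have "(Q *\<^sub>v vec_of_mat (X\<^sup>T)) $ i = (\<Sum>j\<in>{0..<R * R}.
      (if i div R = j mod R \<and> i mod R = j div R then 1 else 0) * vec_of_mat (X\<^sup>T) $ j)"
    using i X by (simp add: Q_def power2_eq_square scalar_prod_def vec_of_mat_def)
  also have "\<dots> = (\<Sum>j\<in>{0..<R * R}. if j = j0 then vec_of_mat (X\<^sup>T) $ j else 0)"
    by (rule sum.cong) (use eq in auto)
  also have "\<dots> = vec_of_mat (X\<^sup>T) $ j0" using j0 by simp
  also have "\<dots> = vec_of_mat X $ i"
    using i j0 X d bnd by (simp add: vec_of_mat_def)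
  finally show "(Q *\<^sub>v vec_of_mat (X\<^sup>T)) $ i = vec_of_mat X $ i" .
qed (use X in \<open>auto simp: Q_def vec_of_mat_def power2_eq_square\<close>)

lemma P_mat_eq:
  "P_mat R = mat (R\<^sup>2) (R\<^sup>2)
    (\<lambda>(i, j). if i div R = j mod R \<and> i mod R = j div R then 1 else 0)"
  unfolding P_mat_def
  by (rule the_equality) (use P_mat_unique[of _ R] P_mat_exists[of _ R] in auto)


section \<open>Block vectors and matrices\<close>

text \<open>
  For block sizes \<open>d 0, d 1, \<dots>\<close>, position \<open>i\<close> is entry \<open>blk_pos d i\<close> of block \<open>blk_num d i\<close>,
  and block \<open>n\<close> occupies the positions from \<open>blk_off d n\<close> (included) to \<open>blk_off d (Suc n)\<close>
  (excluded). Blocks may have size 0.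
\<close>

definition blk_off :: "(nat \<Rightarrow> nat) \<Rightarrow> nat \<Rightarrow> nat" where
  "blk_off d n = (\<Sum>k<n. d k)"

definition blk_num :: "(nat \<Rightarrow> nat) \<Rightarrow> nat \<Rightarrow> nat" where
  "blk_num d i = (LEAST n. i < blk_off d (Suc n))"

definition blk_pos :: "(nat \<Rightarrow> nat) \<Rightarrow> nat \<Rightarrow> nat" where
  "blk_pos d i = i - blk_off d (blk_num d i)"

lemma blk_num_pos:
  assumes "i < d n"
  shows "blk_num d (blk_off d n + i) = n" "blk_pos d (blk_off d n + i) = i"
proof -
  have mono: "blk_off d k \<le> blk_off d l" if "k \<le> l" for k l
    using that unfolding blk_off_def by (intro sum_mono2) auto
  show "blk_num d (blk_off d n + i) = n"
    unfolding blk_num_def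
  proof (rule Least_equality)
    show "blk_off d n + i < blk_off d (Suc n)" using assms by (simp add: blk_off_def)
    show "n \<le> k" if "blk_off d n + i < blk_off d (Suc k)" for k
      using that mono[of "Suc k" n] by (cases "n \<le> k") auto
  qed
  then show "blk_pos d (blk_off d n + i) = i" by (simp add: blk_pos_def)
qed

lemma blk_off_less:
  assumes "n < N" "i < d n"
  shows "blk_off d n + i < blk_off d N"
proof -
  have "blk_off d n + i < blk_off d (Suc n)" using assms by (simp add: blk_off_def)
  also have "\<dots> \<le> blk_off d N"
    using assms unfolding blk_off_def by (intro sum_mono2) auto
  finally show ?thesis .
qed

definition block_vec :: "nat \<Rightarrow> (nat \<Rightarrow> nat) \<Rightarrow> (nat \<Rightarrow> 'a vec) \<Rightarrow> 'a vec" where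
  "block_vec N d v = vec (blk_off d N) (\<lambda>i. v (blk_num d i) $ blk_pos d i)"

definition block_mat :: "nat \<Rightarrow> (nat \<Rightarrow> nat) \<Rightarrow> (nat \<Rightarrow> nat \<Rightarrow> 'a mat) \<Rightarrow> 'a mat" where
  "block_mat N d M = mat (blk_off d N) (blk_off d N)
     (\<lambda>(i, j). M (blk_num d i) (blk_num d j) $$ (blk_pos d i, blk_pos d j))"

definition get_block :: "(nat \<Rightarrow> nat) \<Rightarrow> 'a mat \<Rightarrow> nat \<Rightarrow> nat \<Rightarrow> 'a mat" where
  "get_block d M n m = mat (d n) (d m) (\<lambda>(i, j). M $$ (blk_off d n + i, blk_off d m + j))"

lemma get_block_block_mat:
  assumes "n < N" "m < N" "M n m \<in> carrier_mat (d n) (d m)"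
  shows "get_block d (block_mat N d M) n m = M n m"
  using assms by (intro eq_matI) (auto simp: get_block_def block_mat_def blk_num_pos blk_off_less)


section \<open>The CP model and its Jacobian\<close>

text \<open>An order-\<open>N\<close> tensor is a function of multi-indices, of which only the entries
  \<open>x n < I n\<close>, \<open>n < N\<close>, matter.\<close>

type_synonym tensor = "(nat \<Rightarrow> nat) \<Rightarrow> real"

definition outer_product :: "nat \<Rightarrow> (nat \<Rightarrow> real vec) \<Rightarrow> tensor" where
  "outer_product N v = (\<lambda>x. \<Prod>n<N. v n $ x n)"

definition cp_tensor :: "nat \<Rightarrow> nat \<Rightarrow> (nat \<Rightarrow> real mat) \<Rightarrow> tensor" where
  "cp_tensor N R A = (\<lambda>x. \<Sum>r<R. outer_product N (\<lambda>n. col (A n) r) x)"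

text \<open>Position \<open>l\<close> is read as a mixed-radix number whose least significant digit is the first
  index.\<close>

definition vec_of_tensor :: "nat \<Rightarrow> (nat \<Rightarrow> nat) \<Rightarrow> tensor \<Rightarrow> real vec" where
  "vec_of_tensor N I Y = vec (\<Prod>n<N. I n) (\<lambda>l. Y (\<lambda>n. (l div (\<Prod>k<n. I k)) mod I n))"

definition param_size :: "(nat \<Rightarrow> nat) \<Rightarrow> nat \<Rightarrow> nat \<Rightarrow> nat" where
  "param_size I R n = R * I n"

definition param_vec :: "nat \<Rightarrow> (nat \<Rightarrow> nat) \<Rightarrow> nat \<Rightarrow> (nat \<Rightarrow> real mat) \<Rightarrow> real vec" where
  "param_vec N I R A = block_vec N (param_size I R) (\<lambda>n. vec_of_mat (A n))"

text \<open>The factor matrices encoded by a parameter vector (inverse of \<open>param_vec\<close>).\<close>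

definition factor_mats :: "(nat \<Rightarrow> nat) \<Rightarrow> nat \<Rightarrow> real vec \<Rightarrow> nat \<Rightarrow> real mat" where
  "factor_mats I R a n =
     mat (I n) R (\<lambda>(i, r). a $ (blk_off (param_size I R) n + (r * I n + i)))"

lemma factor_mats_param_vec:
  assumes "n < N" "A n \<in> carrier_mat (I n) R"
  shows "factor_mats I R (param_vec N I R A) n = A n"
proof (rule eq_matI)
  fix i r assume "i < dim_row (A n)" "r < dim_col (A n)"
  then have i: "i < I n" and r: "r < R" using assms by auto
  have "r * I n + i < (r + 1) * I n" using i by simp
  also have "\<dots> \<le> R * I n" using r by (intro mult_right_mono) auto
  finally have l: "r * I n + i < param_size I R n" by (simp add: param_size_def)
  then show "factor_mats I R (param_vec N I R A) n $$ (i, r) = A n $$ (i, r)"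
    using assms i r blk_off_less[of n N "r * I n + i" "param_size I R"] blk_num_pos[of "r * I n + i" "param_size I R" n]
    by (simp add: factor_mats_def param_vec_def block_vec_def vec_of_mat_def param_size_def mult.commute)
qed (use assms in \<open>auto simp: factor_mats_def\<close>)

definition cp_map :: "nat \<Rightarrow> (nat \<Rightarrow> nat) \<Rightarrow> nat \<Rightarrow> real vec \<Rightarrow> real vec" where
  "cp_map N I R a = vec_of_tensor N I (cp_tensor N R (factor_mats I R a))"

definition jacobian :: "(real vec \<Rightarrow> real vec) \<Rightarrow> real vec \<Rightarrow> real mat" where
  "jacobian f a = mat (dim_vec (f a)) (dim_vec a)
     (\<lambda>(i, j). deriv (\<lambda>t. f (a + t \<cdot>\<^sub>v unit_vec (dim_vec a) j) $ i) 0)"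

definition cp_jacobian :: "nat \<Rightarrow> (nat \<Rightarrow> nat) \<Rightarrow> nat \<Rightarrow> (nat \<Rightarrow> real mat) \<Rightarrow> real mat" where
  "cp_jacobian N I R A = jacobian (cp_map N I R) (param_vec N I R A)"

definition H_mat :: "nat \<Rightarrow> (nat \<Rightarrow> nat) \<Rightarrow> nat \<Rightarrow> (nat \<Rightarrow> real mat) \<Rightarrow> real mat" where
  "H_mat N I R A = (cp_jacobian N I R A)\<^sup>T * cp_jacobian N I R A"

definition H_mu :: "nat \<Rightarrow> (nat \<Rightarrow> nat) \<Rightarrow> nat \<Rightarrow> (nat \<Rightarrow> real mat) \<Rightarrow> real \<Rightarrow> real mat" where
  "H_mu N I R A \<mu> = H_mat N I R A + \<mu> \<cdot>\<^sub>m 1\<^sub>m (R * (\<Sum>n<N. I n))"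


section \<open>The matrices in the inversion formula\<close>

definition C_mat :: "(nat \<Rightarrow> real mat) \<Rightarrow> nat \<Rightarrow> real mat" where
  "C_mat A n = (A n)\<^sup>T * A n"

definition Gamma2 :: "nat \<Rightarrow> nat \<Rightarrow> (nat \<Rightarrow> real mat) \<Rightarrow> nat \<Rightarrow> nat \<Rightarrow> real mat" where
  "Gamma2 N R A n m = hadamard_prod R ({..<N} - {n, m}) (C_mat A)"

definition Gamma1 :: "nat \<Rightarrow> nat \<Rightarrow> (nat \<Rightarrow> real mat) \<Rightarrow> nat \<Rightarrow> real mat" where
  "Gamma1 N R A n = Gamma2 N R A n n"

definition Gamma_mu :: "nat \<Rightarrow> nat \<Rightarrow> (nat \<Rightarrow> real mat) \<Rightarrow> real \<Rightarrow> nat \<Rightarrow> real mat" where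
  "Gamma_mu N R A \<mu> n = Gamma1 N R A n + \<mu> \<cdot>\<^sub>m 1\<^sub>m R"

definition Gamma_tilde :: "nat \<Rightarrow> nat \<Rightarrow> (nat \<Rightarrow> real mat) \<Rightarrow> real \<Rightarrow> nat \<Rightarrow> real mat" where
  "Gamma_tilde N R A \<mu> n = mat_inv (Gamma_mu N R A \<mu> n)"

definition K_block :: "nat \<Rightarrow> nat \<Rightarrow> (nat \<Rightarrow> real mat) \<Rightarrow> nat \<Rightarrow> nat \<Rightarrow> real mat" where
  "K_block N R A n m = (if n = m then 0\<^sub>m (R\<^sup>2) (R\<^sup>2)
     else P_mat R * mat_diag (R\<^sup>2) (\<lambda>i. vec_of_mat (Gamma2 N R A n m) $ i))"

definition K_mat :: "nat \<Rightarrow> nat \<Rightarrow> (nat \<Rightarrow> real mat) \<Rightarrow> real mat" where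
  "K_mat N R A = block_mat N (\<lambda>_. R\<^sup>2) (K_block N R A)"

definition Psi_mat :: "nat \<Rightarrow> nat \<Rightarrow> (nat \<Rightarrow> real mat) \<Rightarrow> real \<Rightarrow> real mat" where
  "Psi_mat N R A \<mu> = diag_block_mat (map (\<lambda>n. Gamma_tilde N R A \<mu> n \<otimes>\<^sub>k C_mat A n) [0..<N])"

definition B_mat :: "nat \<Rightarrow> nat \<Rightarrow> (nat \<Rightarrow> real mat) \<Rightarrow> real \<Rightarrow> real mat" where
  "B_mat N R A \<mu> =
     (if invertible_mat (K_mat N R A)
      then mat_inv (mat_inv (K_mat N R A) + Psi_mat N R A \<mu>)
      else K_mat N R A * mat_inv (1\<^sub>m (N * R\<^sup>2) + Psi_mat N R A \<mu> * K_mat N R A))"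

definition B_block :: "nat \<Rightarrow> nat \<Rightarrow> (nat \<Rightarrow> real mat) \<Rightarrow> real \<Rightarrow> nat \<Rightarrow> nat \<Rightarrow> real mat" where
  "B_block N R A \<mu> n m = get_block (\<lambda>_. R\<^sup>2) (B_mat N R A \<mu>) n m"

definition S_tilde :: "nat \<Rightarrow> nat \<Rightarrow> (nat \<Rightarrow> real mat) \<Rightarrow> real \<Rightarrow> nat \<Rightarrow> nat \<Rightarrow> real mat" where
  "S_tilde N R A \<mu> n m =
     (Gamma_tilde N R A \<mu> n \<otimes>\<^sub>k 1\<^sub>m R) * B_block N R A \<mu> n m * (Gamma_tilde N R A \<mu> m \<otimes>\<^sub>k 1\<^sub>m R)"

definition H_tilde_block ::
  "nat \<Rightarrow> (nat \<Rightarrow> nat) \<Rightarrow> nat \<Rightarrow> (nat \<Rightarrow> real mat) \<Rightarrow> real \<Rightarrow> nat \<Rightarrow> nat \<Rightarrow> real mat" where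
  "H_tilde_block N I R A \<mu> n m =
     (if n = m then Gamma_tilde N R A \<mu> n \<otimes>\<^sub>k 1\<^sub>m (I n) else 0\<^sub>m (R * I n) (R * I m))
     - (1\<^sub>m R \<otimes>\<^sub>k A n) * S_tilde N R A \<mu> n m * (1\<^sub>m R \<otimes>\<^sub>k (A m)\<^sup>T)"

definition H_tilde ::
  "nat \<Rightarrow> (nat \<Rightarrow> nat) \<Rightarrow> nat \<Rightarrow> (nat \<Rightarrow> real mat) \<Rightarrow> real \<Rightarrow> real mat" where
  "H_tilde N I R A \<mu> = block_mat N (param_size I R) (H_tilde_block N I R A \<mu>)"

end

theory Submission
  imports Defs "Jordan_Normal_Form.Determinant"
begin

text \<open>
  The Jacobian column of the entry \<open>(i, r)\<close> of \<open>A n\<close> is the outer product of the \<open>r\<close>-th columns of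
  the factors, with the one of mode \<open>n\<close> replaced by the \<open>i\<close>-th unit vector; hence inner products of
  columns factor over the modes. This gives \<open>H\<^sub>\<mu> = G + Z K Z\<^sup>T\<close>, where \<open>G\<close> and \<open>Z\<close> are block diagonal
  with blocks \<open>(\<Gamma> n + \<mu> 1) \<otimes> 1\<close> and \<open>1 \<otimes> A n\<close>. Since \<open>\<Psi>\<^sub>\<mu> = Z\<^sup>T (inv G) Z\<close>, the claim is the
  Woodbury identity. Each \<open>\<Gamma> n + \<mu> 1\<close>, and \<open>H\<^sub>\<mu>\<close> itself, is a Gram matrix plus a positive multiple of
  the identity, hence invertible; it follows that \<open>1 + \<Psi>\<^sub>\<mu> K\<close> has the inverse
  \<open>1 - Z\<^sup>T (inv H\<^sub>\<mu>) Z K\<close>, whether or not \<open>K\<close> is invertible.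
\<close>

unbundle no vec_syntax

section \<open>Inverses, Gram matrices and the Woodbury identity\<close>

text \<open>Over a field a right inverse of a square matrix is also a left inverse, so checking one
  product both proves invertibility and identifies \<open>mat_inv M\<close>.\<close>

lemma mat_inv_eqI:
  assumes M: "M \<in> carrier_mat n n" and X: "X \<in> carrier_mat n n" and MX: "M * X = 1\<^sub>m n"
  shows "invertible_mat M" "mat_inv M = X"
proof -
  have "X * M = 1\<^sub>m n" by (rule mat_mult_left_right_inverse[OF M X MX])
  then show inv: "invertible_mat M"
    using M X MX by (auto simp: invertible_mat_def inverts_mat_def)
  note I = mat_inv[OF M inv]
  have "mat_inv M = mat_inv M * (M * X)" using I(3) MX by simp
  also have "\<dots> = (mat_inv M * M) * X" using assoc_mult_mat[OF I(3) M X] by simp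
  also have "\<dots> = X" using I(2) X by simp
  finally show "mat_inv M = X" .
qed

section \<open>The Woodbury identity for a possibly singular middle factor\<close>

lemma mat_add_minus_cancel:
  fixes X :: "'a::ring mat"
  assumes "X \<in> carrier_mat n m" "Y \<in> carrier_mat n m"
  shows "X + Y - Y = X"
  using assms by (intro eq_matI) auto

text \<open>The correction is written as \<open>K * mat_inv W\<close>, which makes sense for
  singular \<open>K\<close>. Invertibility is assumed of the updated matrix \<open>H\<close> and
  transferred to \<open>W\<close>; the bridge is the push-through identity Z K W = H Gi Z K.\<close>

lemma woodbury:
  fixes G Gi Z Zt K :: "'a::field mat"
  assumes G: "G \<in> carrier_mat t t" and Gi: "Gi \<in> carrier_mat t t" and inv: "G * Gi = 1\<^sub>m t"
    and Z: "Z \<in> carrier_mat t m" and Zt: "Zt \<in> carrier_mat m t" and K: "K \<in> carrier_mat m m"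
    and inv_H: "invertible_mat (G + Z * K * Zt)"
  defines "W \<equiv> 1\<^sub>m m + Zt * Gi * Z * K"
  shows "invertible_mat W"
    and "mat_inv (G + Z * K * Zt) = Gi - Gi * Z * (K * mat_inv W) * (Zt * Gi)"
proof -
  define H where "H = G + Z * K * Zt"
  define Hi where "Hi = mat_inv H"
  note [simp] = G Gi Z Zt K
  have ZK[simp]: "Z * K \<in> carrier_mat t m"
    by (rule mult_carrier_mat[of _ _ m]; simp)
  have H[simp]: "H \<in> carrier_mat t t"
    unfolding H_def by (intro add_carrier_mat mult_carrier_mat[of _ t m] ZK Zt)
  have Hi[simp]: "Hi \<in> carrier_mat t t" and HiH: "Hi * H = 1\<^sub>m t"
    using mat_inv[OF H] inv_H unfolding Hi_def H_def by auto
  have W[simp]: "W \<in> carrier_mat m m"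
    unfolding W_def by (intro add_carrier_mat mult_carrier_mat[OF _ K] mult_carrier_mat[OF _ Z] mult_carrier_mat[OF Zt Gi])
  have assoc: "A * B * C = A * (B * C)"
    if "A \<in> carrier_mat p q" "B \<in> carrier_mat q r" "C \<in> carrier_mat r s"
    for A B C :: "'a mat" and p q r s using that by (rule assoc_mult_mat)
  have GiZ[simp]: "Gi * Z \<in> carrier_mat t m" and ZtGi[simp]: "Zt * Gi \<in> carrier_mat m t"
    by (rule mult_carrier_mat[of _ _ t]; simp)+
  define Q where "Q = Zt * (Gi * (Z * K))"
  have ZtGiZK: "Zt * Gi * Z * K = Q"
    unfolding Q_def by (simp add: assoc[of _ m t _ m _ m] assoc[of _ m t _ t _ m]  assoc[of _ t t _ m _ m])
  have GiZK[simp]: "Gi * (Z * K) \<in> carrier_mat t m" and HiZK[simp]: "Hi * (Z * K) \<in> carrier_mat t m"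
    by (rule mult_carrier_mat[of _ _ t]; simp)+
  have Q[simp]: "Q \<in> carrier_mat m m" unfolding Q_def by (rule mult_carrier_mat[of _ _ t]; simp)
  have KQ[simp]: "K * Q \<in> carrier_mat m m" by (rule mult_carrier_mat[of _ _ m]; simp)
  have W_eq: "W = 1\<^sub>m m + Q" unfolding W_def ZtGiZK ..
  have HGi: "H * Gi = 1\<^sub>m t + Z * (K * (Zt * Gi))"
  proof -
    have "H * Gi = 1\<^sub>m t + Z * K * Zt * Gi"
      unfolding H_def inv[symmetric]
      by (rule add_mult_distrib_mat[OF G _ Gi]) (rule mult_carrier_mat[OF ZK Zt])
    also have "Z * K * Zt * Gi = Z * (K * (Zt * Gi))"
      by (simp only: assoc[OF ZK Zt Gi] assoc[OF Z K ZtGi])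
    finally show ?thesis .
  qed
  have KZtGi[simp]: "K * (Zt * Gi) \<in> carrier_mat m t" by (rule mult_carrier_mat[of _ _ m]; simp)
  have ZKZtGi[simp]: "Z * (K * (Zt * Gi)) \<in> carrier_mat t t" by (rule mult_carrier_mat[of _ _ m]; simp)
  \<comment> \<open>Push-through: both sides expand to Z K + Z K Zt Gi Z K, so \<open>W\<close> on
    the right can be traded for \<open>H\<close> on the left.\<close>
  have ZKW: "Z * (K * W) = H * (Gi * (Z * K))"
  proof -
    have "H * (Gi * (Z * K)) = H * Gi * (Z * K)" by (simp add: assoc[of _ t t _ t _ m])
    also have "\<dots> = Z * K + Z * (K * (Zt * Gi)) * (Z * K)"
      unfolding HGi using add_mult_distrib_mat[OF one_carrier_mat ZKZtGi ZK] left_mult_one_mat[OF ZK]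
      by simp
    also have "Z * (K * (Zt * Gi)) * (Z * K) = Z * (K * Q)"
      unfolding Q_def
      by (simp only: assoc[OF Z KZtGi ZK] assoc[OF K ZtGi ZK] assoc[OF Zt Gi ZK])
    also have "Z * K + Z * (K * Q) = Z * (K * W)"
      unfolding W_eq
      using mult_add_distrib_mat[OF K one_carrier_mat Q] mult_add_distrib_mat[OF Z K KQ] K by simp
    finally show ?thesis by simp
  qed
  \<comment> \<open>The candidate comes from (1 + U V)^-1 = 1 - U (1 + V U)^-1 V with U = Zt and V =
    Gi Z K: then 1 + V U = Gi H, whose inverse is Hi G, and the factor G cancels Gi.\<close>
  define X where "X = 1\<^sub>m m - Zt * (Hi * (Z * K))"
  have ZtHiZK[simp]: "Zt * (Hi * (Z * K)) \<in> carrier_mat m m"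
    by (rule mult_carrier_mat[of _ _ t]; simp)
  have X[simp]: "X \<in> carrier_mat m m" unfolding X_def by (auto intro!: minus_carrier_mat)
  \<comment> \<open>After push-through, Hi meets H and cancels, leaving exactly the term by which
    \<open>W\<close> exceeds the identity.\<close>
  have "Zt * (Hi * (Z * K)) * W = Zt * (Hi * (Z * (K * W)))"
    by (simp add: assoc[of _ m t _ m _ m] assoc[of _ t t _ m _ m] assoc[of _ t m _ m _ m])
  also have "\<dots> = Zt * (Hi * H * (Gi * (Z * K)))"
    unfolding ZKW by (simp add: assoc[of _ t t _ t _ m])
  also have "\<dots> = Q" unfolding HiH Q_def left_mult_one_mat[OF GiZK] ..
  finally have "X * W = 1\<^sub>m m + Q - Q"
    unfolding X_def by (subst minus_mult_distrib_mat[of _ m m _ _ m])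
      (auto simp: W_eq left_mult_one_mat[of _ m m])
  then have "X * W = 1\<^sub>m m" by (simp add: mat_add_minus_cancel[of _ m m])
  then have WX: "W * X = 1\<^sub>m m" by (rule mat_mult_left_right_inverse[OF X W])
  show inv_W: "invertible_mat W" by (rule mat_inv_eqI(1)[OF W X WX])
  define V where "V = mat_inv W"
  have V[simp]: "V \<in> carrier_mat m m" and WV: "W * V = 1\<^sub>m m"
    using mat_inv[OF W inv_W] unfolding V_def by auto
  define U where "U = K * (V * (Zt * Gi))"
  have VZtGi[simp]: "V * (Zt * Gi) \<in> carrier_mat m t" by (rule mult_carrier_mat[of _ _ m]; simp)
  have U[simp]: "U \<in> carrier_mat m t" unfolding U_def by (rule mult_carrier_mat[of _ _ m]; simp)
  have KV: "K * V \<in> carrier_mat m m" and KW: "K * W \<in> carrier_mat m m"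
    by (rule mult_carrier_mat[of _ _ m]; simp)+
  have eq: "Gi * Z * (K * V) * (Zt * Gi) = Gi * (Z * U)"
    by (simp only: assoc[OF GiZ KV ZtGi] assoc[OF K V ZtGi] U_def[symmetric] assoc[OF Gi Z U])
  \<comment> \<open>Push-through in the other direction: \<open>H\<close> becomes \<open>W\<close>,
    which cancels against its inverse \<open>V\<close>. The result is the excess of
    \<open>H * Gi\<close> over the identity, so subtracting it leaves the identity.\<close>
  have "H * (Gi * (Z * U)) = H * (Gi * (Z * K)) * (V * (Zt * Gi))"
    unfolding U_def
    by (simp only: assoc[OF H GiZK VZtGi] assoc[OF Gi ZK VZtGi] assoc[OF Z K VZtGi])
  also have "\<dots> = Z * (K * (W * V * (Zt * Gi)))"
    unfolding ZKW[symmetric]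
    by (simp only: assoc[OF Z KW VZtGi] assoc[OF K W VZtGi] assoc[OF W V ZtGi])
  also have "\<dots> = Z * (K * (Zt * Gi))"
    unfolding WV left_mult_one_mat[OF ZtGi] ..
  finally have HGiZU: "H * (Gi * (Z * U)) = Z * (K * (Zt * Gi))" .
  have ZU[simp]: "Z * U \<in> carrier_mat t t" by (rule mult_carrier_mat[of _ _ m]; simp)
  have GiZU[simp]: "Gi * (Z * U) \<in> carrier_mat t t" by (rule mult_carrier_mat[of _ _ t]; simp)
  have "H * (Gi - Gi * (Z * U)) = 1\<^sub>m t"
    unfolding mult_minus_distrib_mat[OF H Gi GiZU] HGiZU HGi
    by (rule mat_add_minus_cancel[OF one_carrier_mat ZKZtGi])
  then have "mat_inv H = Gi - Gi * (Z * U)"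
    by (intro mat_inv_eqI(2)[OF H]) (auto intro!: minus_carrier_mat)
  then show "mat_inv (G + Z * K * Zt) = Gi - Gi * Z * (K * mat_inv W) * (Zt * Gi)"
    unfolding eq[unfolded V_def] H_def .
qed

lemma mat_inv_add_inverse:
  fixes K P :: "'a::field mat"
  assumes K: "K \<in> carrier_mat m m" and P: "P \<in> carrier_mat m m" and inv_K: "invertible_mat K"
    and inv_W: "invertible_mat (1\<^sub>m m + P * K)"
  shows "invertible_mat (mat_inv K + P)"
    and "mat_inv (mat_inv K + P) = K * mat_inv (1\<^sub>m m + P * K)"
proof -
  note Ki = mat_inv[OF K inv_K]
  have W: "1\<^sub>m m + P * K \<in> carrier_mat m m" using K P by simp
  note V = mat_inv[OF W inv_W]
  have S: "mat_inv K + P \<in> carrier_mat m m" using P by simp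
  have KV: "K * mat_inv (1\<^sub>m m + P * K) \<in> carrier_mat m m" using K V by simp
  have "(mat_inv K + P) * (K * mat_inv (1\<^sub>m m + P * K)) = (mat_inv K + P) * K * mat_inv (1\<^sub>m m + P * K)"
    using assoc_mult_mat[OF S K V(3)] by simp
  also have "(mat_inv K + P) * K = 1\<^sub>m m + P * K"
    using add_mult_distrib_mat[OF Ki(3) P K] Ki(2) by simp
  also have "\<dots> * mat_inv (1\<^sub>m m + P * K) = 1\<^sub>m m" by (rule V(1))
  finally have "(mat_inv K + P) * (K * mat_inv (1\<^sub>m m + P * K)) = 1\<^sub>m m" .
  from mat_inv_eqI[OF S KV this]
  show "invertible_mat (mat_inv K + P)"
    and "mat_inv (mat_inv K + P) = K * mat_inv (1\<^sub>m m + P * K)" by auto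
qed

text \<open>Positive definiteness: a kernel vector v satisfies 0 = (sum of squares) + \<mu> |v|^2,
  hence v = 0. The Gram vectors are indexed by an arbitrary finite set, so that both tensor
  positions and tuples of indices can serve.\<close>

lemma gram_plus_scalar_invertible:
  fixes M :: "real mat" and F :: "'x \<Rightarrow> nat \<Rightarrow> real"
  assumes M: "M \<in> carrier_mat n n" and "finite S" and "\<mu> > 0"
    and gram: "\<And>i j. i < n \<Longrightarrow> j < n \<Longrightarrow> M $$ (i, j) = (\<Sum>x\<in>S. F x i * F x j)"
  shows "invertible_mat (M + \<mu> \<cdot>\<^sub>m 1\<^sub>m n)"
proof -
  define Q where "Q = M + \<mu> \<cdot>\<^sub>m 1\<^sub>m n"
  have Q: "Q \<in> carrier_mat n n" using M by (simp add: Q_def)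
  have "det Q \<noteq> 0"
  proof
    assume "det Q = 0"
    then obtain v where v: "v \<in> carrier_vec n" "v \<noteq> 0\<^sub>v n" "Q *\<^sub>v v = 0\<^sub>v n"
      using det_0_iff_vec_prod_zero[OF Q] by auto
    have row: "(\<Sum>j<n. M $$ (i, j) * v $ j) + \<mu> * v $ i = 0" if i: "i < n" for i
    proof -
      have "0 = (Q *\<^sub>v v) $ i" using v i by simp
      also have "\<dots> = (\<Sum>j<n. Q $$ (i, j) * v $ j)"
        using i v(1) Q by (simp add: scalar_prod_def atLeast0LessThan)
      also have "\<dots> = (\<Sum>j<n. M $$ (i, j) * v $ j + (if i = j then \<mu> * v $ j else 0))"
        using i M by (intro sum.cong) (auto simp: Q_def algebra_simps)
      also have "\<dots> = (\<Sum>j<n. M $$ (i, j) * v $ j) + \<mu> * v $ i"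
        using i by (simp add: sum.distrib)
      finally show ?thesis by simp
    qed
    \<comment> \<open>The kernel equations are paired with v; moving the sum over \<open>S\<close>
      outermost then exhibits the quadratic form of \<open>M\<close> as a sum of squares.\<close>
    have "0 = (\<Sum>i<n. v $ i * ((\<Sum>j<n. M $$ (i, j) * v $ j) + \<mu> * v $ i))"
      using row by simp
    also have "\<dots> = (\<Sum>i<n. \<Sum>j<n. v $ i * v $ j * M $$ (i, j)) + \<mu> * (\<Sum>i<n. (v $ i)\<^sup>2)"
      by (simp add: algebra_simps sum.distrib sum_distrib_left power2_eq_square)
    also have "(\<Sum>i<n. \<Sum>j<n. v $ i * v $ j * M $$ (i, j))
        = (\<Sum>i<n. \<Sum>j<n. \<Sum>x\<in>S. v $ i * F x i * (v $ j * F x j))"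
      by (intro sum.cong) (auto simp: gram sum_distrib_left algebra_simps)
    also have "\<dots> = (\<Sum>i<n. \<Sum>x\<in>S. \<Sum>j<n. v $ i * F x i * (v $ j * F x j))"
      by (intro sum.cong refl) (rule sum.swap)
    also have "\<dots> = (\<Sum>x\<in>S. \<Sum>i<n. \<Sum>j<n. v $ i * F x i * (v $ j * F x j))"
      by (rule sum.swap)
    also have "\<dots> = (\<Sum>x\<in>S. (\<Sum>i<n. v $ i * F x i)\<^sup>2)"
      by (simp add: power2_eq_square sum_product)
    finally have "(\<Sum>x\<in>S. (\<Sum>i<n. v $ i * F x i)\<^sup>2) + \<mu> * (\<Sum>i<n. (v $ i)\<^sup>2) = 0" by simp
    moreover have "(\<Sum>x\<in>S. (\<Sum>i<n. v $ i * F x i)\<^sup>2) \<ge> 0" by (simp add: sum_nonneg)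
    ultimately have "\<mu> * (\<Sum>i<n. (v $ i)\<^sup>2) \<le> 0" by linarith
    then have "(\<Sum>i<n. (v $ i)\<^sup>2) = 0"
      using \<open>\<mu> > 0\<close> by (simp add: mult_le_0_iff order_antisym sum_nonneg)
    then have "\<forall>i<n. v $ i = 0" by (simp add: sum_nonneg_eq_0_iff)
    then have "v = 0\<^sub>v n" using v(1) by (intro eq_vecI) auto
    with v(2) show False by simp
  qed
  then have "Q \<in> Units (ring_mat TYPE(real) n ())" by (rule det_non_zero_imp_unit[OF Q])
  then show ?thesis
    using Q unfolding Q_def[symmetric]
    by (auto simp: Units_def ring_mat_def invertible_mat_def inverts_mat_def)
qed

section \<open>Kronecker products and block matrices\<close>

lemma index_mult_mat_sum:
  assumes "i < dim_row X" "j < dim_col Y" "dim_col X = dim_row Y"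
  shows "(X * Y) $$ (i, j) = (\<Sum>k<dim_row Y. X $$ (i, k) * Y $$ (k, j))"
proof -
  have "dim_vec (col Y j) = dim_row Y" by simp
  then show ?thesis using assms by (simp add: scalar_prod_def atLeast0LessThan)
qed

lemma index_mult_carrier_mat:
  assumes "X \<in> carrier_mat a b" "Y \<in> carrier_mat b c" "i < a" "j < c"
  shows "(X * Y) $$ (i, j) = (\<Sum>k<b. X $$ (i, k) * Y $$ (k, j))"
  using assms by (subst index_mult_mat_sum) auto

section \<open>Flat indices as pairs and as block positions\<close>

lemma sum_lessThan_add:
  fixes f :: "nat \<Rightarrow> 'a::comm_monoid_add"
  shows "(\<Sum>l<a + b. f l) = (\<Sum>l<a. f l) + (\<Sum>i<b. f (a + i))"
  by (induction b) (auto simp: add.assoc)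

lemma sum_lessThan_mult:
  fixes f :: "nat \<Rightarrow> 'a::comm_monoid_add"
  shows "(\<Sum>l<m * n. f l) = (\<Sum>a<m. \<Sum>b<n. f (a * n + b))"
  by (induction m) (auto simp: sum_lessThan_add add.commute[of n])

lemma sum_lessThan_blk_off:
  fixes f :: "nat \<Rightarrow> 'a::comm_monoid_add"
  shows "(\<Sum>l<blk_off d N. f l) = (\<Sum>k<N. \<Sum>i<d k. f (blk_off d k + i))"
  by (induction N) (auto simp: blk_off_def sum_lessThan_add)

lemma mult_add_less:
  fixes a m b n :: nat
  assumes "a < m" "b < n"
  shows "a * n + b < m * n"
proof -
  have "a * n + b < Suc a * n" using assms by simp
  also have "\<dots> \<le> m * n" using assms by (intro mult_right_mono) auto
  finally show ?thesis .
qed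

lemma less_mult_cases:
  fixes i m n :: nat
  assumes "i < m * n"
  obtains a b where "a < m" "b < n" "i = a * n + b"
proof
  show "i div n < m" using assms by (simp add: less_mult_imp_div_less)
  show "i mod n < n" using assms by (cases n) auto
qed simp

lemma mult_add_eq_iff:
  fixes a b n c d :: nat
  assumes "b < n" "d < n"
  shows "a * n + b = c * n + d \<longleftrightarrow> a = c \<and> b = d"
proof
  assume *: "a * n + b = c * n + d"
  show "a = c \<and> b = d"
    using arg_cong[OF *, of "\<lambda>x. x div n"] arg_cong[OF *, of "\<lambda>x. x mod n"] assms by simp
qed simp

lemma less_blk_off_cases:
  assumes "i < blk_off d N"
  obtains n p where "n < N" "p < d n" "i = blk_off d n + p"
proof -
  have "\<exists>n p. n < N \<and> p < d n \<and> i = blk_off d n + p"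
    using assms
  proof (induction N)
    case (Suc N)
    show ?case
    proof (cases "i < blk_off d N")
      case True
      then show ?thesis using Suc.IH less_Suc_eq by blast
    next
      case False
      then have "i - blk_off d N < d N \<and> i = blk_off d N + (i - blk_off d N)"
        using Suc.prems by (auto simp: blk_off_def)
      then show ?thesis by blast
    qed
  qed (simp add: blk_off_def)
  then show thesis using that by blast
qed

lemma blk_off_add_eq_iff:
  assumes "p < d n" "q < d m"
  shows "blk_off d n + p = blk_off d m + q \<longleftrightarrow> n = m \<and> p = q"
  using blk_num_pos[of p d n] blk_num_pos[of q d m] assms by metis

section \<open>Kronecker products\<close>

lemma dim_kronecker [simp]:
  "dim_row (X \<otimes>\<^sub>k Y) = dim_row X * dim_row Y" "dim_col (X \<otimes>\<^sub>k Y) = dim_col X * dim_col Y"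
  by (auto simp: kronecker_def)

lemma kronecker_carrier [intro]:
  "X \<in> carrier_mat a b \<Longrightarrow> Y \<in> carrier_mat c d \<Longrightarrow> X \<otimes>\<^sub>k Y \<in> carrier_mat (a * c) (b * d)"
  by (auto simp: kronecker_def)

lemma index_kronecker:
  assumes "X \<in> carrier_mat a b" "Y \<in> carrier_mat c d" "i < a" "j < b" "p < c" "q < d"
  shows "(X \<otimes>\<^sub>k Y) $$ (i * c + p, j * d + q) = X $$ (i, j) * Y $$ (p, q)"
  using assms mult_add_less[of i a p c] mult_add_less[of j b q d] by (auto simp: kronecker_def)

text \<open>The mixed-product rule: splitting the summation index by division with remainder turns
  each entry into a double sum that factors.\<close>

lemma kronecker_mult:
  fixes X Y :: "'a::comm_semiring_0 mat"
  assumes X: "X \<in> carrier_mat a b" and X': "X' \<in> carrier_mat b c"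
    and Y: "Y \<in> carrier_mat p q" and Y': "Y' \<in> carrier_mat q r"
  shows "(X \<otimes>\<^sub>k Y) * (X' \<otimes>\<^sub>k Y') = (X * X') \<otimes>\<^sub>k (Y * Y')"
proof (rule eq_matI)
  fix u v assume "u < dim_row ((X * X') \<otimes>\<^sub>k (Y * Y'))" "v < dim_col ((X * X') \<otimes>\<^sub>k (Y * Y'))"
  then have u: "u < a * p" and v: "v < c * r" using assms by auto
  obtain i i' where i: "i < a" "i' < p" "u = i * p + i'" using u by (rule less_mult_cases)
  obtain j j' where j: "j < c" "j' < r" "v = j * r + j'" using v by (rule less_mult_cases)
  have "((X \<otimes>\<^sub>k Y) * (X' \<otimes>\<^sub>k Y')) $$ (u, v)
      = (\<Sum>l<b * q. (X \<otimes>\<^sub>k Y) $$ (u, l) * (X' \<otimes>\<^sub>k Y') $$ (l, v))"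
    using u v assms by (subst index_mult_mat_sum) auto
  also have "\<dots> = (\<Sum>k<b. \<Sum>k'<q. X $$ (i, k) * X' $$ (k, j) * (Y $$ (i', k') * Y' $$ (k', j')))"
    unfolding sum_lessThan_mult i(3) j(3)
    by (intro sum.cong refl)
      (simp add: index_kronecker[OF X Y] index_kronecker[OF X' Y'] i j mult_ac)
  also have "\<dots> = (X * X') $$ (i, j) * (Y * Y') $$ (i', j')"
    using i j assms by (simp add: index_mult_mat_sum sum_product del: index_mult_mat(1))
  also have "\<dots> = ((X * X') \<otimes>\<^sub>k (Y * Y')) $$ (u, v)"
    unfolding i(3) j(3)
    by (rule index_kronecker[symmetric, OF mult_carrier_mat[OF X X'] mult_carrier_mat[OF Y Y']])
      (use i j in auto)
  finally show "((X \<otimes>\<^sub>k Y) * (X' \<otimes>\<^sub>k Y')) $$ (u, v) = ((X * X') \<otimes>\<^sub>k (Y * Y')) $$ (u, v)" .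
qed (use assms in auto)

lemma kronecker_one: "1\<^sub>m a \<otimes>\<^sub>k 1\<^sub>m b = (1\<^sub>m (a * b) :: 'a::semiring_1 mat)"
proof (rule eq_matI)
  fix u v assume "u < dim_row (1\<^sub>m (a * b) :: 'a mat)" "v < dim_col (1\<^sub>m (a * b) :: 'a mat)"
  then have u: "u < a * b" and v: "v < a * b" by auto
  obtain i i' where i: "i < a" "i' < b" "u = i * b + i'" using u by (rule less_mult_cases)
  obtain j j' where j: "j < a" "j' < b" "v = j * b + j'" using v by (rule less_mult_cases)
  show "(1\<^sub>m a \<otimes>\<^sub>k 1\<^sub>m b) $$ (u, v) = (1\<^sub>m (a * b) :: 'a mat) $$ (u, v)"
    using i j u v
    by (simp add: index_kronecker[OF one_carrier_mat one_carrier_mat] mult_add_eq_iff)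
qed auto

section \<open>Block matrices with rectangular blocks\<close>

definition rect_block_mat ::
  "nat \<Rightarrow> (nat \<Rightarrow> nat) \<Rightarrow> (nat \<Rightarrow> nat) \<Rightarrow> (nat \<Rightarrow> nat \<Rightarrow> 'a mat) \<Rightarrow> 'a mat" where
  "rect_block_mat N d e M = mat (blk_off d N) (blk_off e N)
     (\<lambda>(i, j). M (blk_num d i) (blk_num e j) $$ (blk_pos d i, blk_pos e j))"

text \<open>Row and column block sizes are kept apart because the blocks
  \<open>1\<^sub>m R \<otimes>\<^sub>k A n\<close> are rectangular.\<close>

definition block_diag ::
  "nat \<Rightarrow> (nat \<Rightarrow> nat) \<Rightarrow> (nat \<Rightarrow> nat) \<Rightarrow> (nat \<Rightarrow> 'a::zero mat) \<Rightarrow> 'a mat" where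
  "block_diag N d e D = rect_block_mat N d e (\<lambda>n m. if n = m then D n else 0\<^sub>m (d n) (e m))"

lemma block_mat_eq_rect: "block_mat N d M = rect_block_mat N d d M"
  by (simp add: block_mat_def rect_block_mat_def)

lemma rect_block_mat_carrier [simp]:
  "rect_block_mat N d e M \<in> carrier_mat (blk_off d N) (blk_off e N)"
  by (simp add: rect_block_mat_def)

lemma block_diag_carrier [simp]: "block_diag N d e D \<in> carrier_mat (blk_off d N) (blk_off e N)"
  by (simp add: block_diag_def)

lemma index_rect_block_mat:
  assumes "n < N" "m < N" "i < d n" "j < e m"
  shows "rect_block_mat N d e M $$ (blk_off d n + i, blk_off e m + j) = M n m $$ (i, j)"
  using assms by (simp add: rect_block_mat_def blk_off_less blk_num_pos)

lemma index_block_diag: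
  assumes "n < N" "m < N" "i < d n" "j < e m"
  shows "block_diag N d e D $$ (blk_off d n + i, blk_off e m + j) = (if n = m then D n $$ (i, j) else 0)"
  using assms by (auto simp: block_diag_def index_rect_block_mat)

lemma eq_block_matI:
  assumes "X \<in> carrier_mat (blk_off d N) (blk_off e N)" "Y \<in> carrier_mat (blk_off d N) (blk_off e N)"
    and "\<And>n m i j. n < N \<Longrightarrow> m < N \<Longrightarrow> i < d n \<Longrightarrow> j < e m \<Longrightarrow>
      X $$ (blk_off d n + i, blk_off e m + j) = Y $$ (blk_off d n + i, blk_off e m + j)"
  shows "X = Y"
proof (rule eq_matI)
  fix u v assume "u < dim_row Y" "v < dim_col Y"
  then have "u < blk_off d N" "v < blk_off e N" using assms by auto
  then show "X $$ (u, v) = Y $$ (u, v)"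
    by (elim less_blk_off_cases) (use assms(3) in simp)
qed (use assms in auto)

lemma block_diag_mult_rect:
  fixes D :: "nat \<Rightarrow> 'a::semiring_0 mat"
  assumes D: "\<And>n. n < N \<Longrightarrow> D n \<in> carrier_mat (d n) (e n)"
    and M: "\<And>n m. n < N \<Longrightarrow> m < N \<Longrightarrow> M n m \<in> carrier_mat (e n) (f m)"
  shows "block_diag N d e D * rect_block_mat N e f M = rect_block_mat N d f (\<lambda>n m. D n * M n m)"
proof (rule eq_block_matI[where d = d and e = f and N = N])
  fix n m i j assume nm: "n < N" "m < N" and ij: "i < d n" "j < f m"
  have "(block_diag N d e D * rect_block_mat N e f M) $$ (blk_off d n + i, blk_off f m + j)
      = (\<Sum>l<blk_off e N. block_diag N d e D $$ (blk_off d n + i, l) * rect_block_mat N e f M $$ (l, blk_off f m + j))"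
    using nm ij blk_off_less[of n N i d] blk_off_less[of m N j f]
    by (subst index_mult_mat_sum) (simp_all add: block_diag_def rect_block_mat_def)
  \<comment> \<open>The flat sum is cut into blocks, and in block row \<open>n\<close> of a block
    diagonal matrix only block \<open>n\<close> survives.\<close>
  also have "\<dots> = (\<Sum>k<N. if k = n then \<Sum>p<e k. D n $$ (i, p) * M n m $$ (p, j) else 0)"
    unfolding sum_lessThan_blk_off
    by (intro sum.cong refl) (use nm ij in \<open>auto simp: index_block_diag index_rect_block_mat\<close>)
  also have "\<dots> = (D n * M n m) $$ (i, j)"
    using nm ij D[OF nm(1)] M[OF nm] by (simp add: index_mult_mat_sum del: index_mult_mat(1))
  finally show "(block_diag N d e D * rect_block_mat N e f M) $$ (blk_off d n + i, blk_off f m + j)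
      = rect_block_mat N d f (\<lambda>n m. D n * M n m) $$ (blk_off d n + i, blk_off f m + j)"
    using nm ij by (simp add: index_rect_block_mat)
qed (auto intro: mult_carrier_mat[OF block_diag_carrier])

lemma rect_mult_block_diag:
  fixes D :: "nat \<Rightarrow> 'a::semiring_0 mat"
  assumes D: "\<And>n. n < N \<Longrightarrow> D n \<in> carrier_mat (e n) (f n)"
    and M: "\<And>n m. n < N \<Longrightarrow> m < N \<Longrightarrow> M n m \<in> carrier_mat (d n) (e m)"
  shows "rect_block_mat N d e M * block_diag N e f D = rect_block_mat N d f (\<lambda>n m. M n m * D m)"
proof (rule eq_block_matI[where d = d and e = f and N = N])
  fix n m i j assume nm: "n < N" "m < N" and ij: "i < d n" "j < f m"
  have "(rect_block_mat N d e M * block_diag N e f D) $$ (blk_off d n + i, blk_off f m + j)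
      = (\<Sum>l<blk_off e N. rect_block_mat N d e M $$ (blk_off d n + i, l) * block_diag N e f D $$ (l, blk_off f m + j))"
    using nm ij blk_off_less[of n N i d] blk_off_less[of m N j f]
    by (subst index_mult_mat_sum) (simp_all add: block_diag_def rect_block_mat_def)
  also have "\<dots> = (\<Sum>k<N. if k = m then \<Sum>p<e k. M n m $$ (i, p) * D m $$ (p, j) else 0)"
    unfolding sum_lessThan_blk_off
    by (intro sum.cong refl) (use nm ij in \<open>auto simp: index_block_diag index_rect_block_mat\<close>)
  also have "\<dots> = (M n m * D m) $$ (i, j)"
    using nm ij D[OF nm(2)] M[OF nm] by (simp add: index_mult_mat_sum del: index_mult_mat(1))
  finally show "(rect_block_mat N d e M * block_diag N e f D) $$ (blk_off d n + i, blk_off f m + j)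
      = rect_block_mat N d f (\<lambda>n m. M n m * D m) $$ (blk_off d n + i, blk_off f m + j)"
    using nm ij by (simp add: index_rect_block_mat)
qed (auto intro: mult_carrier_mat[OF rect_block_mat_carrier])

lemma rect_block_mat_cong:
  assumes "\<And>n m. n < N \<Longrightarrow> m < N \<Longrightarrow> M n m = M' n m"
  shows "rect_block_mat N d e M = rect_block_mat N d e M'"
  by (rule eq_block_matI[where d = d and e = e and N = N]) (use assms in \<open>auto simp: index_rect_block_mat\<close>)

lemma block_diag_mult:
  fixes D :: "nat \<Rightarrow> 'a::semiring_0 mat"
  assumes D: "\<And>n. n < N \<Longrightarrow> D n \<in> carrier_mat (d n) (e n)"
    and E: "\<And>n. n < N \<Longrightarrow> E n \<in> carrier_mat (e n) (f n)"
  shows "block_diag N d e D * block_diag N e f E = block_diag N d f (\<lambda>n. D n * E n)"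
  unfolding block_diag_def[of N e f]
  by (subst block_diag_mult_rect) (use D E in \<open>auto simp: block_diag_def intro!: rect_block_mat_cong right_mult_zero_mat\<close>)

lemma block_diag_one: "block_diag N d d (\<lambda>n. 1\<^sub>m (d n)) = (1\<^sub>m (blk_off d N) :: 'a::semiring_1 mat)"
  by (rule eq_block_matI[where d = d and e = d and N = N])
    (auto simp: index_block_diag blk_off_less blk_off_add_eq_iff)

lemma block_diag_cong:
  assumes "\<And>n. n < N \<Longrightarrow> D n = D' n"
  shows "block_diag N d e D = block_diag N d e D'"
  unfolding block_diag_def by (intro rect_block_mat_cong) (use assms in auto)

lemma rect_block_mat_get_block:
  assumes "X \<in> carrier_mat (blk_off d N) (blk_off d N)"
  shows "rect_block_mat N d d (get_block d X) = X"
  by (rule eq_block_matI[where d = d and e = d and N = N])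
    (use assms in \<open>auto simp: index_rect_block_mat get_block_def\<close>)

text \<open>Brings \<open>Psi_mat\<close>, built from a list of blocks, into the offset-based form.
  The induction splits off the last block, since offsets accumulate from the left.\<close>

lemma diag_block_mat_eq_block_diag:
  assumes "\<And>n. n < N \<Longrightarrow> D n \<in> carrier_mat (d n) (e n)"
  shows "diag_block_mat (map D [0..<N]) = block_diag N d e D"
  using assms
proof (induction N)
  case 0
  show ?case by (intro eq_matI) (auto simp: block_diag_def rect_block_mat_def blk_off_def)
next
  case (Suc N)
  let ?X = "diag_block_mat (map D [0..<N])"
  have X: "?X = block_diag N d e D" using Suc by simp
  have eq: "diag_block_mat (map D [0..<Suc N]) =
     four_block_mat ?X (0\<^sub>m (blk_off d N) (e N)) (0\<^sub>m (d N) (blk_off e N)) (D N)"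
    using Suc.prems[of N] carrier_matD[OF block_diag_carrier[of N d e D]]
    by (simp add: diag_block_mat_last X)
  have S: "blk_off d (Suc N) = blk_off d N + d N" "blk_off e (Suc N) = blk_off e N + e N"
    by (auto simp: blk_off_def)
  \<comment> \<open>This test decides which of the four corners of \<open>four_block_mat\<close> an
    index falls in.\<close>
  have le: "blk_off c n + i < blk_off c N \<longleftrightarrow> n \<noteq> N" if "n < Suc N" "i < c n" for c n i
    using that by (cases "n = N") (auto intro: blk_off_less)
  show ?case
  proof (rule eq_block_matI[where d = d and e = e and N = "Suc N"])
    show "diag_block_mat (map D [0..<Suc N]) \<in> carrier_mat (blk_off d (Suc N)) (blk_off e (Suc N))"
      unfolding eq S X by (rule four_block_carrier_mat) (use Suc.prems in auto)
    fix n m i j assume nm: "n < Suc N" "m < Suc N" and ij: "i < d n" "j < e m"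
    have "blk_off d n + i < blk_off d N + d N" "blk_off e m + j < blk_off e N + e N"
      using blk_off_less[of n "Suc N" i d] blk_off_less[of m "Suc N" j e] nm ij unfolding S by auto
    moreover have "dim_row (block_diag N d e D) = blk_off d N" "dim_col (block_diag N d e D) = blk_off e N"
      using block_diag_carrier by blast+
    moreover have "D N \<in> carrier_mat (d N) (e N)" using Suc.prems by simp
    ultimately show "diag_block_mat (map D [0..<Suc N]) $$ (blk_off d n + i, blk_off e m + j)
        = block_diag (Suc N) d e D $$ (blk_off d n + i, blk_off e m + j)"
      unfolding eq index_block_diag[of n "Suc N" m i d j e, OF nm ij] X
      using nm ij le[of n i d] le[of m j e]
      by (cases "n = N"; cases "m = N") (auto simp: index_block_diag)
  qed simp
qed

section \<open>The Jacobian and its Gram matrix\<close>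

definition digit :: "(nat \<Rightarrow> nat) \<Rightarrow> nat \<Rightarrow> nat \<Rightarrow> nat" where
  "digit I l n = (l div (\<Prod>k<n. I k)) mod I n"

lemma digit_less:
  assumes "l < (\<Prod>n<N. I n)" "n < N"
  shows "digit I l n < I n"
proof -
  have "(\<Prod>n<N. I n) \<noteq> 0" using assms(1) by linarith
  then have "I n \<noteq> 0" using assms(2) by auto
  then show ?thesis by (simp add: digit_def)
qed

text \<open>The added term is a multiple of the place value of digit \<open>n\<close> times its
  radix \<open>I n\<close>, so it disappears modulo \<open>I n\<close>.\<close>

lemma digit_add:
  assumes "n < N" and "r < (\<Prod>k<N. I k)"
  shows "digit I (q * (\<Prod>k<N. I k) + r) n = digit I r n"
proof -
  define P where "P = (\<Prod>k<n. I k)"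
  define S where "S = (\<Prod>k\<in>{Suc n..<N}. I k)"
  have "(\<Prod>k<N. I k) = (\<Prod>k<Suc n. I k) * S"
    unfolding S_def using prod.atLeastLessThan_concat[of 0 "Suc n" N I] assms(1)
    by (simp only: atLeast0LessThan)
  then have eq: "(\<Prod>k<N. I k) = P * I n * S" by (simp add: P_def)
  have "P > 0" using assms(2) unfolding eq by (cases P) auto
  have "q * (P * I n * S) + r = r + I n * (q * S) * P" by (simp add: algebra_simps)
  then have "(q * (P * I n * S) + r) div P = I n * (q * S) + r div P"
    by (rule ssubst) (use \<open>P > 0\<close> div_mult_self1[of P r "I n * (q * S)"] in simp)
  then show ?thesis by (simp add: digit_def eq P_def[symmetric])
qed

text \<open>Positions enumerate all multi-indices exactly once, so this is the distributive law. It
  is what makes inner products of Jacobian columns factor over the modes. The induction peels off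
  the slowest index, which is the leading digit.\<close>

lemma sum_prod_digit:
  fixes g :: "nat \<Rightarrow> nat \<Rightarrow> 'a::comm_semiring_1"
  shows "(\<Sum>l<(\<Prod>n<N. I n). \<Prod>n<N. g n (digit I l n)) = (\<Prod>n<N. \<Sum>i<I n. g n i)"
proof (induction N)
  case (Suc N)
  define P where "P = (\<Prod>n<N. I n)"
  have top: "digit I (q * P + r) N = q" if "q < I N" "r < P" for q r
    using that by (simp add: digit_def P_def[symmetric])
  have low: "digit I (q * P + r) n = digit I r n" if "n < N" "r < P" for q r n
    using that unfolding P_def by (rule digit_add)
  have "(\<Sum>l<(\<Prod>n<Suc N. I n). \<Prod>n<Suc N. g n (digit I l n))
      = (\<Sum>q<I N. \<Sum>r<P. (\<Prod>n<N. g n (digit I (q * P + r) n)) * g N (digit I (q * P + r) N))"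
    by (simp add: P_def[symmetric] mult.commute[of P] sum_lessThan_mult)
  also have "\<dots> = (\<Sum>q<I N. \<Sum>r<P. (\<Prod>n<N. g n (digit I r n)) * g N q)"
    by (intro sum.cong prod.cong arg_cong2[of _ _ _ _ "(*)"] refl)
      (auto simp: top low)
  also have "\<dots> = (\<Prod>n<Suc N. \<Sum>i<I n. g n i)"
    by (simp add: Suc.IH[folded P_def, symmetric] sum_distrib_left[symmetric] sum_distrib_right[symmetric])
  finally show ?case .
qed simp

text \<open>The partial derivative of tensor entry \<open>l\<close> with respect to entry
  \<open>(i, r)\<close> of \<open>A n\<close>.\<close>

definition cp_jacobian_entry ::
  "nat \<Rightarrow> (nat \<Rightarrow> nat) \<Rightarrow> (nat \<Rightarrow> real mat) \<Rightarrow> nat \<Rightarrow> nat \<Rightarrow> nat \<Rightarrow> nat \<Rightarrow> real" where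
  "cp_jacobian_entry N I A l n i r =
     (\<Prod>k<N. if k = n then of_bool (digit I l k = i) else A k $$ (digit I l k, r))"

lemma cp_map_index:
  assumes "l < (\<Prod>n<N. I n)"
  shows "cp_map N I R a $ l = (\<Sum>c<R. \<Prod>k<N. factor_mats I R a k $$ (digit I l k, c))"
  using assms digit_less[OF assms]
  by (auto simp: cp_map_def vec_of_tensor_def cp_tensor_def outer_product_def digit_def[symmetric]
      factor_mats_def intro!: sum.cong prod.cong)

text \<open>A product is affine in any single factor, so the perturbed model is exactly affine in t
  and its derivative can be read off as a coefficient.\<close>

lemma prod_add_single:
  fixes f :: "nat \<Rightarrow> 'a::comm_ring_1"
  assumes "n < N"
  shows "(\<Prod>k<N. f k + (if k = n then t * b else 0))
    = (\<Prod>k<N. f k) + t * (\<Prod>k<N. if k = n then b else f k)"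
proof -
  have split: "(\<Prod>k<N. h k) = h n * (\<Prod>k\<in>{..<N} - {n}. h k)" for h :: "nat \<Rightarrow> 'a"
    using assms by (intro prod.remove) auto
  have rest: "(\<Prod>k\<in>{..<N} - {n}. h k) = (\<Prod>k\<in>{..<N} - {n}. f k)"
    if "\<And>k. k \<noteq> n \<Longrightarrow> h k = f k" for h :: "nat \<Rightarrow> 'a"
    using that by (intro prod.cong) auto
  show ?thesis
    unfolding split[of "\<lambda>k. f k + (if k = n then t * b else 0)"] split[of f]
      split[of "\<lambda>k. if k = n then b else f k"]
    using rest[of "\<lambda>k. f k + (if k = n then t * b else 0)"] rest[of "\<lambda>k. if k = n then b else f k"]
    by (simp add: algebra_simps)
qed

lemma param_size_blk_off: "blk_off (param_size I R) N = R * (\<Sum>n<N. I n)"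
  by (simp add: blk_off_def param_size_def sum_distrib_left)

lemma cp_jacobian_carrier:
  "cp_jacobian N I R A \<in> carrier_mat (\<Prod>n<N. I n) (blk_off (param_size I R) N)"
  by (simp add: cp_jacobian_def jacobian_def cp_map_def vec_of_tensor_def param_vec_def block_vec_def)

lemma cp_jacobian_index:
  assumes A: "\<And>n. n < N \<Longrightarrow> A n \<in> carrier_mat (I n) R"
    and l: "l < (\<Prod>n<N. I n)" and n: "n < N" and r: "r < R" and i: "i < I n"
  shows "cp_jacobian N I R A $$ (l, blk_off (param_size I R) n + (r * I n + i))
    = cp_jacobian_entry N I A l n i r"
proof -
  define d where "d = param_size I R"
  define a where "a = param_vec N I R A"
  define j where "j = blk_off d n + (r * I n + i)"
  have dim_a: "dim_vec a = blk_off d N"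
    by (simp add: a_def d_def param_vec_def block_vec_def)
  have pos: "c * I k + x < d k" if "c < R" "x < I k" for c k x
    using mult_add_less[OF that] by (simp add: d_def param_size_def)
  have j: "j < blk_off d N" unfolding j_def using n pos[OF r i] by (rule blk_off_less)
  \<comment> \<open>Moving coordinate \<open>j\<close> of the parameter vector changes entry
    \<open>(i, r)\<close> of factor \<open>n\<close> and nothing else, because a flat position
    determines its mode, column and row.\<close>
  have factor: "factor_mats I R (a + t \<cdot>\<^sub>v unit_vec (dim_vec a) j) k $$ (x, c)
      = A k $$ (x, c) + (if k = n then t * of_bool (x = i \<and> c = r) else 0)"
    if k: "k < N" and x: "x < I k" and c: "c < R" for t k x c
  proof -
    have lt: "blk_off d k + (c * I k + x) < blk_off d N" using k pos[OF c x] by (rule blk_off_less)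
    have "A k $$ (x, c) = factor_mats I R a k $$ (x, c)"
      unfolding a_def using factor_mats_param_vec[of k N A I R, OF k A[OF k]] by simp
    also have "\<dots> = a $ (blk_off d k + (c * I k + x))"
      using x c by (simp add: factor_mats_def d_def)
    finally have "A k $$ (x, c) = a $ (blk_off d k + (c * I k + x))" .
    moreover have "blk_off d k + (c * I k + x) = j \<longleftrightarrow> k = n \<and> c = r \<and> x = i"
      using x i by (auto simp: j_def blk_off_add_eq_iff[where d = d, OF pos[OF c x] pos[OF r i]] mult_add_eq_iff)
    ultimately show ?thesis
      using x c lt j dim_a by (auto simp: factor_mats_def d_def[symmetric])
  qed
  have "cp_map N I R (a + t \<cdot>\<^sub>v unit_vec (dim_vec a) j) $ l
      = (\<Sum>c<R. \<Prod>k<N. A k $$ (digit I l k, c)) + t * cp_jacobian_entry N I A l n i r" for t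
  proof -
    \<comment> \<open>The rate of change of the mode-\<open>n\<close> factor in the
      \<open>c\<close>-th rank-one term at position \<open>l\<close>.\<close>
    define b where "b c = (of_bool (digit I l n = i \<and> c = r) :: real)" for c
    have "cp_map N I R (a + t \<cdot>\<^sub>v unit_vec (dim_vec a) j) $ l
        = (\<Sum>c<R. \<Prod>k<N. A k $$ (digit I l k, c) + (if k = n then t * b c else 0))"
      unfolding cp_map_index[OF l] b_def
      by (intro sum.cong prod.cong refl) (auto simp: factor digit_less[OF l])
    also have "\<dots> = (\<Sum>c<R. (\<Prod>k<N. A k $$ (digit I l k, c))
        + t * (\<Prod>k<N. if k = n then b c else A k $$ (digit I l k, c)))"
      by (intro sum.cong refl prod_add_single n)
    also have "\<dots> = (\<Sum>c<R. \<Prod>k<N. A k $$ (digit I l k, c))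
        + t * (\<Sum>c<R. \<Prod>k<N. if k = n then b c else A k $$ (digit I l k, c))"
      by (simp add: sum.distrib sum_distrib_left)
    also have "(\<Sum>c<R. \<Prod>k<N. if k = n then b c else A k $$ (digit I l k, c))
        = (\<Sum>c<R. if c = r then cp_jacobian_entry N I A l n i r else 0)"
    proof (intro sum.cong refl)
      fix c
      \<comment> \<open>Rank-one terms other than the \<open>r\<close>-th do not involve the
        perturbed entry: their mode-\<open>n\<close> factor here is zero.\<close>
      have "(\<Prod>k<N. if k = n then b c else A k $$ (digit I l k, c)) = 0" if "c \<noteq> r"
        using that n by (intro prod_zero) (auto simp: b_def)
      moreover have "(\<Prod>k<N. if k = n then b r else A k $$ (digit I l k, r))
          = cp_jacobian_entry N I A l n i r"
        unfolding cp_jacobian_entry_def by (intro prod.cong) (auto simp: b_def)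
      ultimately show "(\<Prod>k<N. if k = n then b c else A k $$ (digit I l k, c))
          = (if c = r then cp_jacobian_entry N I A l n i r else 0)" by auto
    qed
    finally show ?thesis using r by simp
  qed
  then have "deriv (\<lambda>t. cp_map N I R (a + t \<cdot>\<^sub>v unit_vec (dim_vec a) j) $ l) 0
      = cp_jacobian_entry N I A l n i r"
    by (intro DERIV_imp_deriv) (auto intro!: derivative_eq_intros)
  then show ?thesis
    using l j dim_a
    by (simp add: cp_jacobian_def jacobian_def a_def[symmetric] d_def[symmetric] j_def[symmetric]
        cp_map_def vec_of_tensor_def)
qed

section \<open>Gram matrices of the Jacobian and of the factors\<close>

lemma C_mat_index:
  assumes "A k \<in> carrier_mat (I k) R" "r < R" "s < R"
  shows "C_mat A k $$ (r, s) = (\<Sum>x<I k. A k $$ (x, r) * A k $$ (x, s))"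
  using assms by (simp add: C_mat_def index_mult_mat_sum del: index_mult_mat(1))

lemma H_mat_carrier: "H_mat N I R A \<in> carrier_mat (blk_off (param_size I R) N) (blk_off (param_size I R) N)"
  unfolding H_mat_def using cp_jacobian_carrier[of N I R A] by simp

lemma H_mat_gram:
  assumes "u < blk_off (param_size I R) N" "v < blk_off (param_size I R) N"
  shows "H_mat N I R A $$ (u, v)
    = (\<Sum>l<(\<Prod>n<N. I n). cp_jacobian N I R A $$ (l, u) * cp_jacobian N I R A $$ (l, v))"
  using assms cp_jacobian_carrier[of N I R A]
  by (auto simp: H_mat_def index_mult_mat_sum simp del: index_mult_mat(1))

text \<open>By \<open>sum_prod_digit\<close> the inner product of two Jacobian columns is a product
  over modes. Modes outside \<open>{n, m}\<close> contribute entries of \<open>C_mat\<close>; the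
  remaining ones involve unit vectors and collapse.\<close>

lemma H_mat_index:
  assumes A: "\<And>n. n < N \<Longrightarrow> A n \<in> carrier_mat (I n) R"
    and n: "n < N" and m: "m < N" and r: "r < R" and s: "s < R" and i: "i < I n" and j: "j < I m"
  defines "d \<equiv> param_size I R"
  shows "H_mat N I R A $$ (blk_off d n + (r * I n + i), blk_off d m + (s * I m + j))
    = Gamma2 N R A n m $$ (r, s) *
      (if n = m then of_bool (i = j) else A n $$ (i, s) * A m $$ (j, r))"
proof -
  have pos: "blk_off d k + (c * I k + x) < blk_off d N" if "k < N" "c < R" "x < I k" for c k x
    using blk_off_less[of k N "c * I k + x" d] mult_add_less[OF that(2,3)] that(1)
    by (simp add: d_def param_size_def)
  define g where "g k x = (if k = n then of_bool (x = i) else A k $$ (x, r))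
      * (if k = m then of_bool (x = j) else A k $$ (x, s))" for k x
  have "H_mat N I R A $$ (blk_off d n + (r * I n + i), blk_off d m + (s * I m + j))
      = (\<Sum>l<(\<Prod>n<N. I n). \<Prod>k<N. g k (digit I l k))"
    using pos[OF n r i] pos[OF m s j] unfolding d_def
    by (subst H_mat_gram)
      (auto simp: cp_jacobian_index[of N A I R, OF A] n m r s i j cp_jacobian_entry_def g_def prod.distrib[symmetric]
        intro!: sum.cong)
  also have "\<dots> = (\<Prod>k<N. \<Sum>x<I k. g k x)" by (rule sum_prod_digit)
  \<comment> \<open>For n = m the set \<open>{n, m}\<close> is a singleton, so one split covers
    diagonal and off-diagonal blocks.\<close>
  also have "\<dots> = (\<Prod>k\<in>{..<N} - {n, m}. \<Sum>x<I k. g k x) * (\<Prod>k\<in>{n, m}. \<Sum>x<I k. g k x)"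
    using n m by (intro prod.subset_diff) auto
  also have "(\<Prod>k\<in>{..<N} - {n, m}. \<Sum>x<I k. g k x) = Gamma2 N R A n m $$ (r, s)"
    using r s by (auto simp: Gamma2_def hadamard_prod_def g_def C_mat_index[of A _ I R, OF A] intro!: prod.cong)
  also have "(\<Prod>k\<in>{n, m}. \<Sum>x<I k. g k x)
      = (if n = m then of_bool (i = j) else A n $$ (i, s) * A m $$ (j, r))"
  proof (cases "n = m")
    case True
    have "(\<Sum>x<I n. g n x) = (\<Sum>x<I n. if x = i then of_bool (i = j) else 0)"
      by (intro sum.cong) (auto simp: g_def True)
    then show ?thesis using True i by simp
  next
    case False
    \<comment> \<open>The unit vector of one Jacobian column meets a factor column of the other, so
      r and s appear crosswise; this crossing is the origin of the permutation
      \<open>P_mat R\<close> in \<open>K_block\<close>.\<close>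
    have "(\<Sum>x<I n. g n x) = (\<Sum>x<I n. if x = i then A n $$ (i, s) else 0)"
      by (intro sum.cong) (auto simp: g_def False)
    moreover have "(\<Sum>x<I m. g m x) = (\<Sum>x<I m. if x = j then A m $$ (j, r) else 0)"
      using False by (intro sum.cong) (auto simp: g_def)
    ultimately show ?thesis using False i j by simp
  qed
  finally show ?thesis .
qed

text \<open>Expanding the product of sums over index tuples shows \<Gamma> n to be the Gram matrix
  of the Khatri-Rao product of the factors of the other modes, as in the Schur product
  theorem.\<close>

lemma Gamma1_gram:
  assumes A: "\<And>n. n < N \<Longrightarrow> A n \<in> carrier_mat (I n) R" and r: "r < R" and s: "s < R"
  shows "Gamma1 N R A n $$ (r, s) = (\<Sum>x\<in>(\<Pi>\<^sub>E k\<in>{..<N} - {n}. {..<I k}).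
    (\<Prod>k\<in>{..<N} - {n}. A k $$ (x k, r)) * (\<Prod>k\<in>{..<N} - {n}. A k $$ (x k, s)))"
proof -
  have "Gamma1 N R A n $$ (r, s)
      = (\<Prod>k\<in>{..<N} - {n}. \<Sum>x<I k. A k $$ (x, r) * A k $$ (x, s))"
    using r s
    by (auto simp: Gamma1_def Gamma2_def hadamard_prod_def C_mat_index[of A _ I R, OF A] intro!: prod.cong)
  also have "\<dots> = (\<Sum>x\<in>(\<Pi>\<^sub>E k\<in>{..<N} - {n}. {..<I k}).
      \<Prod>k\<in>{..<N} - {n}. A k $$ (x k, r) * A k $$ (x k, s))"
    by (rule prod_sum_PiE) auto
  finally show ?thesis by (simp add: prod.distrib)
qed

section \<open>The damped Hessian as a low-rank update\<close>

lemma Gamma2_carrier [simp]: "Gamma2 N R A n m \<in> carrier_mat R R"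
  by (simp add: Gamma2_def hadamard_prod_def)

lemma Gamma_mu_carrier [simp]: "Gamma_mu N R A \<mu> n \<in> carrier_mat R R"
  by (simp add: Gamma_mu_def Gamma1_def)

lemma K_block_carrier: "K_block N R A n m \<in> carrier_mat (R\<^sup>2) (R\<^sup>2)"
  unfolding K_block_def P_mat_eq by (auto intro!: mult_carrier_mat[of _ _ "R\<^sup>2"])

text \<open>The permutation exchanges the two halves of an index. Position \<open>b * R + c\<close>
  of the column-major \<open>vec_of_mat\<close> holds entry \<open>(c, b)\<close>, which is the
  scaling of that column.\<close>

lemma K_block_index:
  assumes "n \<noteq> m" "a < R" "p < R" "b < R" "c < R"
  shows "K_block N R A n m $$ (a * R + p, b * R + c)
    = (if a = c \<and> p = b then Gamma2 N R A n m $$ (c, b) else 0)"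
proof -
  have P: "P_mat R \<in> carrier_mat (R\<^sup>2) (R\<^sup>2)" by (simp add: P_mat_eq)
  have "a * R + p < R\<^sup>2" "b * R + c < R\<^sup>2"
    using mult_add_less[of a R p R] mult_add_less[of b R c R] assms by (auto simp: power2_eq_square)
  then show ?thesis
    using assms carrier_matD[OF Gamma2_carrier[of N R A n m]]
    by (simp add: K_block_def mat_diag_mult_right[OF P])
      (auto simp: P_mat_eq vec_of_mat_def power2_eq_square)
qed

text \<open>Only one term survives: the left identity forces a = r, the permutation forces c = a and
  p = b, and the right identity forces b = s. The exchange thus reproduces the crosswise r and s of
  \<open>H_mat_index\<close>.\<close>

lemma sandwich_K_block_index:
  assumes An: "A n \<in> carrier_mat (I n) R" and Am: "A m \<in> carrier_mat (I m) R" and "n \<noteq> m"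
    and r: "r < R" and s: "s < R" and i: "i < I n" and j: "j < I m"
  shows "((1\<^sub>m R \<otimes>\<^sub>k A n) * K_block N R A n m * (1\<^sub>m R \<otimes>\<^sub>k (A m)\<^sup>T)) $$ (r * I n + i, s * I m + j)
    = Gamma2 N R A n m $$ (r, s) * (A n $$ (i, s) * A m $$ (j, r))"
proof -
  define L where "L = (1\<^sub>m R \<otimes>\<^sub>k A n) * K_block N R A n m"
  have Zn: "1\<^sub>m R \<otimes>\<^sub>k A n \<in> carrier_mat (R * I n) (R * R)" using An by auto
  have AmT: "(A m)\<^sup>T \<in> carrier_mat R (I m)" using Am by simp
  then have Zm: "1\<^sub>m R \<otimes>\<^sub>k (A m)\<^sup>T \<in> carrier_mat (R * R) (R * I m)" by auto
  have K: "K_block N R A n m \<in> carrier_mat (R * R) (R * R)"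
    using K_block_carrier[of N R A n m] by (simp add: power2_eq_square)
  have L: "L \<in> carrier_mat (R * I n) (R * R)" unfolding L_def by (rule mult_carrier_mat[OF Zn K])
  have ri: "r * I n + i < R * I n" and sj: "s * I m + j < R * I m"
    using mult_add_less r s i j by auto
  have L_index: "L $$ (r * I n + i, b * R + c)
      = (if c = r then A n $$ (i, b) * Gamma2 N R A n m $$ (r, b) else 0)"
    if b: "b < R" and c: "c < R" for b c
  proof -
    have "L $$ (r * I n + i, b * R + c)
        = (\<Sum>a<R. \<Sum>p<R. (1\<^sub>m R \<otimes>\<^sub>k A n) $$ (r * I n + i, a * R + p)
            * K_block N R A n m $$ (a * R + p, b * R + c))"
      unfolding L_def index_mult_carrier_mat[OF Zn K ri mult_add_less[OF b c]] sum_lessThan_mult ..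
    also have "\<dots> = (\<Sum>a<R. \<Sum>p<R. if p = b
        then (if a = r then (if c = r then A n $$ (i, b) * Gamma2 N R A n m $$ (r, b) else 0) else 0) else 0)"
      by (intro sum.cong refl)
        (use r i b c \<open>n \<noteq> m\<close> in \<open>auto simp: index_kronecker[OF one_carrier_mat An] K_block_index\<close>)
    also have "\<dots> = (if c = r then A n $$ (i, b) * Gamma2 N R A n m $$ (r, b) else 0)"
      using r b by simp
    finally show ?thesis .
  qed
  have "(L * (1\<^sub>m R \<otimes>\<^sub>k (A m)\<^sup>T)) $$ (r * I n + i, s * I m + j)
      = (\<Sum>b<R. \<Sum>c<R. L $$ (r * I n + i, b * R + c)
          * (1\<^sub>m R \<otimes>\<^sub>k (A m)\<^sup>T) $$ (b * R + c, s * I m + j))"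
    unfolding index_mult_carrier_mat[OF L Zm ri sj] sum_lessThan_mult ..
  also have "\<dots> = (\<Sum>b<R. \<Sum>c<R. if c = r then (if b = s
      then Gamma2 N R A n m $$ (r, s) * (A n $$ (i, s) * A m $$ (j, r)) else 0) else 0)"
    by (intro sum.cong refl)
      (use s j Am in \<open>auto simp: index_kronecker[OF one_carrier_mat AmT] L_index\<close>)
  finally show ?thesis using r s by (simp add: L_def)
qed

text \<open>Compared entry by entry within blocks: the off-diagonal blocks are the sandwiched blocks
  of K, while the diagonal blocks, including the damping, come from the first summand alone.\<close>

lemma H_mu_eq:
  assumes A: "\<And>n. n < N \<Longrightarrow> A n \<in> carrier_mat (I n) R"
  defines "d \<equiv> param_size I R" and "e \<equiv> (\<lambda>_. R\<^sup>2)"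
  shows "H_mu N I R A \<mu> = block_diag N d d (\<lambda>n. Gamma_mu N R A \<mu> n \<otimes>\<^sub>k 1\<^sub>m (I n))
    + block_diag N d e (\<lambda>n. 1\<^sub>m R \<otimes>\<^sub>k A n) * K_mat N R A * block_diag N e d (\<lambda>n. 1\<^sub>m R \<otimes>\<^sub>k (A n)\<^sup>T)"
    (is "_ = ?G + ?Z * _ * ?Zt")
proof -
  let ?T = "\<lambda>n m. (1\<^sub>m R \<otimes>\<^sub>k A n) * K_block N R A n m * (1\<^sub>m R \<otimes>\<^sub>k (A m)\<^sup>T)"
  have Z: "1\<^sub>m R \<otimes>\<^sub>k A n \<in> carrier_mat (d n) (e n)" if "n < N" for n
    using A[OF that] by (auto simp: d_def e_def param_size_def power2_eq_square)
  have Zt: "1\<^sub>m R \<otimes>\<^sub>k (A n)\<^sup>T \<in> carrier_mat (e n) (d n)" if "n < N" for n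
    using A[OF that] by (auto simp: d_def e_def param_size_def power2_eq_square)
  have K: "K_block N R A n m \<in> carrier_mat (e n) (e m)" for n m
    using K_block_carrier by (simp add: e_def)
  have ZKZt: "?Z * K_mat N R A * ?Zt = rect_block_mat N d d ?T"
    unfolding K_mat_def block_mat_eq_rect e_def[symmetric]
    using Z Zt K by (simp add: block_diag_mult_rect rect_mult_block_diag mult_carrier_mat[OF Z K])
  show ?thesis
    unfolding ZKZt
  proof (rule eq_block_matI[where d = d and e = d and N = N])
    show "H_mu N I R A \<mu> \<in> carrier_mat (blk_off d N) (blk_off d N)"
      using H_mat_carrier[of N I R A] by (simp add: H_mu_def d_def param_size_blk_off)
    fix n m u v assume nm: "n < N" "m < N" and uv: "u < d n" "v < d m"
    obtain r i where r: "r < R" and i: "i < I n" and u: "u = r * I n + i"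
      using uv(1) unfolding d_def param_size_def by (rule less_mult_cases)
    obtain s j where s: "s < R" and j: "j < I m" and v: "v = s * I m + j"
      using uv(2) unfolding d_def param_size_def by (rule less_mult_cases)
    have ob: "blk_off d n + u < blk_off d N" "blk_off d m + v < blk_off d N"
      using nm uv by (auto intro: blk_off_less)
    \<comment> \<open>The diagonal blocks of K are zero, so the update does not touch the diagonal
      blocks.\<close>
    have T0: "?T n n $$ (u, v) = 0" if "n = m"
    proof -
      have "?T n n = 0\<^sub>m (d n) (e n) * (1\<^sub>m R \<otimes>\<^sub>k (A n)\<^sup>T)"
        using right_mult_zero_mat[OF Z[OF nm(1)], of "e n"] by (simp add: K_block_def e_def)
      then show ?thesis using left_mult_zero_mat[OF Zt[OF nm(1)], of "d n"] uv that by simp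
    qed
    have "H_mu N I R A \<mu> $$ (blk_off d n + u, blk_off d m + v)
        = Gamma2 N R A n m $$ (r, s) * (if n = m then of_bool (i = j) else A n $$ (i, s) * A m $$ (j, r))
          + \<mu> * of_bool (n = m \<and> r = s \<and> i = j)"
    proof -
      have "blk_off d n + u = blk_off d m + v \<longleftrightarrow> n = m \<and> r = s \<and> i = j"
        unfolding blk_off_add_eq_iff[where d = d, OF uv] using i j by (auto simp: u v mult_add_eq_iff)
      then show ?thesis
        using ob H_mat_carrier[of N I R A] H_mat_index[of N A I R n m r s i j, OF A nm r s i j]
        by (auto simp: H_mu_def d_def param_size_blk_off u v)
    qed
    also have "\<dots> = ?G $$ (blk_off d n + u, blk_off d m + v) + ?T n m $$ (u, v)"
    proof (cases "n = m")
      case True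
      have "(Gamma_mu N R A \<mu> n \<otimes>\<^sub>k 1\<^sub>m (I n)) $$ (r * I n + i, s * I n + j)
          = (Gamma2 N R A n n $$ (r, s) + \<mu> * of_bool (r = s)) * of_bool (i = j)"
        using r s i j True carrier_matD[OF Gamma2_carrier[of N R A n n]]
        by (subst index_kronecker[OF Gamma_mu_carrier one_carrier_mat])
          (auto simp: Gamma_mu_def Gamma1_def)
      then show ?thesis
        using T0 True uv nm by (simp add: index_block_diag u v)
    next
      case False
      then show ?thesis
        using nm uv sandwich_K_block_index[of A n I R m r s i j N, OF A[OF nm(1)] A[OF nm(2)] False r s i j]
        by (simp add: index_block_diag u v)
    qed
    also have "\<dots> = (?G + rect_block_mat N d d ?T) $$ (blk_off d n + u, blk_off d m + v)"
      using nm uv ob carrier_matD[OF rect_block_mat_carrier[of N d d ?T]]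
      by (simp add: index_rect_block_mat)
    finally show "H_mu N I R A \<mu> $$ (blk_off d n + u, blk_off d m + v)
      = (?G + rect_block_mat N d d ?T) $$ (blk_off d n + u, blk_off d m + v)" .
  qed simp
qed

section \<open>Invertibility and the inversion formula\<close>

lemma Gamma_mu_invertible:
  assumes A: "\<And>n. n < N \<Longrightarrow> A n \<in> carrier_mat (I n) R" and "\<mu> > 0"
  shows "invertible_mat (Gamma_mu N R A \<mu> n)"
proof -
  have "Gamma1 N R A n \<in> carrier_mat R R" by (simp add: Gamma1_def)
  then show ?thesis
    unfolding Gamma_mu_def
    by (rule gram_plus_scalar_invertible[OF _ _ \<open>\<mu> > 0\<close> Gamma1_gram[of N A I R, OF A]])
      (auto intro!: finite_PiE)
qed

lemma H_mu_invertible: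
  assumes "\<mu> > 0"
  shows "invertible_mat (H_mu N I R A \<mu>)"
  unfolding H_mu_def param_size_blk_off[symmetric]
  by (rule gram_plus_scalar_invertible[OF H_mat_carrier _ assms H_mat_gram]) auto

text \<open>The invertibility clauses certify that each \<open>mat_inv\<close> taken in the formula
  is a genuine inverse and not the unspecified value \<open>the None\<close>.\<close>

theorem theorem4p4:
  fixes N R :: nat and I :: "nat \<Rightarrow> nat" and A :: "nat \<Rightarrow> real mat" and \<mu> :: real
  assumes "N \<ge> 2"
    and "\<And>n. n < N \<Longrightarrow> A n \<in> carrier_mat (I n) R"
    and "\<mu> > 0"
  shows "(\<forall>n<N. invertible_mat (Gamma_mu N R A \<mu> n))
    \<and> (invertible_mat (K_mat N R A)
         \<longrightarrow> invertible_mat (mat_inv (K_mat N R A) + Psi_mat N R A \<mu>))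
    \<and> (\<not> invertible_mat (K_mat N R A)
         \<longrightarrow> invertible_mat (1\<^sub>m (N * R\<^sup>2) + Psi_mat N R A \<mu> * K_mat N R A))
    \<and> invertible_mat (H_mu N I R A \<mu>)
    \<and> mat_inv (H_mu N I R A \<mu>) = H_tilde N I R A \<mu>"
proof -
  note A = assms(2)
  define d where "d = param_size I R"
  define e where "e = (\<lambda>_::nat. R\<^sup>2)"
  define t where "t = blk_off d N"
  define \<Gamma>i where "\<Gamma>i = Gamma_tilde N R A \<mu>"
  define G where "G = block_diag N d d (\<lambda>n. Gamma_mu N R A \<mu> n \<otimes>\<^sub>k 1\<^sub>m (I n))"
  define Gi where "Gi = block_diag N d d (\<lambda>n. \<Gamma>i n \<otimes>\<^sub>k 1\<^sub>m (I n))"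
  define Z where "Z = block_diag N d e (\<lambda>n. 1\<^sub>m R \<otimes>\<^sub>k A n)"
  define Zt where "Zt = block_diag N e d (\<lambda>n. 1\<^sub>m R \<otimes>\<^sub>k (A n)\<^sup>T)"
  define K where "K = K_mat N R A"
  define B where "B = B_mat N R A \<mu>"
  have inv_\<Gamma>: "invertible_mat (Gamma_mu N R A \<mu> n)" for n
    by (rule Gamma_mu_invertible[of N A I R, OF A \<open>\<mu> > 0\<close>])
  have \<Gamma>i: "\<Gamma>i n \<in> carrier_mat R R" "Gamma_mu N R A \<mu> n * \<Gamma>i n = 1\<^sub>m R" for n
    using mat_inv[OF Gamma_mu_carrier inv_\<Gamma>] by (auto simp: \<Gamma>i_def Gamma_tilde_def)
  have An: "A n \<in> carrier_mat (I n) R" "(A n)\<^sup>T \<in> carrier_mat R (I n)" if "n < N" for n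
    using A[OF that] by auto
  have d: "d n = R * I n" for n by (simp add: d_def param_size_def)
  have e: "e n = R * R" for n by (simp add: e_def power2_eq_square)
  have m: "blk_off e N = N * R\<^sup>2" by (simp add: blk_off_def e_def)
  have [simp]: "G \<in> carrier_mat t t" "Gi \<in> carrier_mat t t" "Z \<in> carrier_mat t (N * R\<^sup>2)"
    "Zt \<in> carrier_mat (N * R\<^sup>2) t"
    unfolding G_def Gi_def Z_def Zt_def t_def m[symmetric] by simp_all
  have K[simp]: "K \<in> carrier_mat (N * R\<^sup>2) (N * R\<^sup>2)"
    unfolding K_def K_mat_def block_mat_eq_rect e_def[symmetric] m[symmetric] by simp
  have "G * Gi = block_diag N d d (\<lambda>n. 1\<^sub>m (d n))"
    unfolding G_def Gi_def
    by (subst block_diag_mult)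
      (auto simp: d \<Gamma>i kronecker_mult[OF Gamma_mu_carrier \<Gamma>i(1) one_carrier_mat one_carrier_mat]
        kronecker_one)
  then have inv_G: "G * Gi = 1\<^sub>m t" by (simp add: block_diag_one t_def)
  have H: "H_mu N I R A \<mu> = G + Z * K * Zt"
    unfolding G_def Z_def Zt_def K_def d_def e_def by (rule H_mu_eq) (rule A)
  have inv_H: "invertible_mat (G + Z * K * Zt)"
    using H_mu_invertible[OF \<open>\<mu> > 0\<close>] unfolding H[symmetric] .
  have GiZ: "Gi * Z = block_diag N d e (\<lambda>n. \<Gamma>i n \<otimes>\<^sub>k A n)"
  proof -
    have "Gi * Z = block_diag N d e (\<lambda>n. (\<Gamma>i n \<otimes>\<^sub>k 1\<^sub>m (I n)) * (1\<^sub>m R \<otimes>\<^sub>k A n))"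
      unfolding Gi_def Z_def by (rule block_diag_mult) (use \<Gamma>i An in \<open>auto simp: d e\<close>)
    also have "\<dots> = block_diag N d e (\<lambda>n. \<Gamma>i n \<otimes>\<^sub>k A n)"
      by (rule block_diag_cong)
        (simp add: right_mult_one_mat[OF \<Gamma>i(1)] left_mult_one_mat[OF \<Gamma>i(1)] left_mult_one_mat[OF An(1)]
          right_mult_one_mat[OF An(2)] kronecker_mult[OF \<Gamma>i(1) one_carrier_mat one_carrier_mat An(1)])
    finally show ?thesis .
  qed
  have ZtGi: "Zt * Gi = block_diag N e d (\<lambda>n. \<Gamma>i n \<otimes>\<^sub>k (A n)\<^sup>T)"
  proof -
    have "Zt * Gi = block_diag N e d (\<lambda>n. (1\<^sub>m R \<otimes>\<^sub>k (A n)\<^sup>T) * (\<Gamma>i n \<otimes>\<^sub>k 1\<^sub>m (I n)))"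
      unfolding Gi_def Zt_def by (rule block_diag_mult) (use \<Gamma>i An in \<open>auto simp: d e\<close>)
    also have "\<dots> = block_diag N e d (\<lambda>n. \<Gamma>i n \<otimes>\<^sub>k (A n)\<^sup>T)"
      by (rule block_diag_cong)
        (simp add: right_mult_one_mat[OF \<Gamma>i(1)] left_mult_one_mat[OF \<Gamma>i(1)] left_mult_one_mat[OF An(1)]
          right_mult_one_mat[OF An(2)] kronecker_mult[OF one_carrier_mat \<Gamma>i(1) An(2) one_carrier_mat])
    finally show ?thesis .
  qed
  have \<Psi>: "Zt * Gi * Z = Psi_mat N R A \<mu>"
  proof -
    have "Zt * Gi * Z = block_diag N e e (\<lambda>n. (\<Gamma>i n \<otimes>\<^sub>k (A n)\<^sup>T) * (1\<^sub>m R \<otimes>\<^sub>k A n))"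
      unfolding ZtGi Z_def by (rule block_diag_mult) (use \<Gamma>i An in \<open>auto simp: d e\<close>)
    also have "\<dots> = block_diag N e e (\<lambda>n. \<Gamma>i n \<otimes>\<^sub>k C_mat A n)"
      by (rule block_diag_cong)
        (simp add: right_mult_one_mat[OF \<Gamma>i(1)] left_mult_one_mat[OF \<Gamma>i(1)] left_mult_one_mat[OF An(1)]
          right_mult_one_mat[OF An(2)] C_mat_def kronecker_mult[OF \<Gamma>i(1) one_carrier_mat An(2) An(1)])
    also have "\<dots> = Psi_mat N R A \<mu>"
      unfolding Psi_mat_def \<Gamma>i_def[symmetric]
      by (rule diag_block_mat_eq_block_diag[symmetric])
        (use \<Gamma>i An in \<open>auto simp: e C_mat_def intro!: kronecker_carrier mult_carrier_mat\<close>)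
    finally show ?thesis .
  qed
  define W where "W = 1\<^sub>m (N * R\<^sup>2) + Psi_mat N R A \<mu> * K"
  have \<Psi>_carrier: "Psi_mat N R A \<mu> \<in> carrier_mat (N * R\<^sup>2) (N * R\<^sup>2)"
    unfolding \<Psi>[symmetric] by (rule mult_carrier_mat[of _ _ t], rule mult_carrier_mat[of _ _ t]) simp_all
  have inv_W: "invertible_mat W"
    and inverse: "mat_inv (G + Z * K * Zt) = Gi - Gi * Z * (K * mat_inv W) * (Zt * Gi)"
    using woodbury[of G t Gi Z "N * R\<^sup>2" Zt K] inv_G inv_H by (simp_all add: \<Psi> W_def)
  note Kinv = mat_inv_add_inverse[OF K \<Psi>_carrier _ inv_W[unfolded W_def]]
  \<comment> \<open>The singular case holds by definition, the invertible one by
    \<open>mat_inv_add_inverse\<close>; from here on no case distinction on \<open>K\<close>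
    remains.\<close>
  have B: "B = K * mat_inv W"
    unfolding B_def B_mat_def K_def[symmetric] W_def using Kinv by simp
  have "W \<in> carrier_mat (N * R\<^sup>2) (N * R\<^sup>2)"
    unfolding W_def by (intro add_carrier_mat mult_carrier_mat[OF \<Psi>_carrier K])
  then have B_carrier: "B \<in> carrier_mat (blk_off e N) (blk_off e N)"
    unfolding B m by (rule mult_carrier_mat[OF K mat_inv(3)[OF _ inv_W]])
  let ?S = "\<lambda>n m. (1\<^sub>m R \<otimes>\<^sub>k A n) * S_tilde N R A \<mu> n m * (1\<^sub>m R \<otimes>\<^sub>k (A m)\<^sup>T)"
  \<comment> \<open>The outer factors split by the mixed-product rule, and the parts of the form
    \<open>\<Gamma>i n \<otimes>\<^sub>k 1\<^sub>m R\<close> move inwards to form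
    \<open>S_tilde\<close>.\<close>
  have S: "(\<Gamma>i n \<otimes>\<^sub>k A n) * get_block e B n m * (\<Gamma>i m \<otimes>\<^sub>k (A m)\<^sup>T) = ?S n m"
    if nm: "n < N" "m < N" for n m
  proof -
    have Bc: "get_block e B n m \<in> carrier_mat (R * R) (R * R)"
      by (simp add: get_block_def e)
    define X where "X = \<Gamma>i n \<otimes>\<^sub>k 1\<^sub>m R"
    define Y where "Y = \<Gamma>i m \<otimes>\<^sub>k 1\<^sub>m R"
    define P where "P = 1\<^sub>m R \<otimes>\<^sub>k A n"
    define Q where "Q = 1\<^sub>m R \<otimes>\<^sub>k (A m)\<^sup>T"
    have c: "X \<in> carrier_mat (R * R) (R * R)" "Y \<in> carrier_mat (R * R) (R * R)"
      "P \<in> carrier_mat (R * I n) (R * R)" "Q \<in> carrier_mat (R * R) (R * I m)"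
      unfolding X_def Y_def P_def Q_def using \<Gamma>i An nm by auto
    have PX: "\<Gamma>i n \<otimes>\<^sub>k A n = P * X"
      unfolding P_def X_def by (simp add: left_mult_one_mat[OF \<Gamma>i(1)] right_mult_one_mat[OF An(1)[OF nm(1)]]
        kronecker_mult[OF one_carrier_mat \<Gamma>i(1) An(1)[OF nm(1)] one_carrier_mat])
    have YQ: "\<Gamma>i m \<otimes>\<^sub>k (A m)\<^sup>T = Y * Q"
      unfolding Q_def Y_def by (simp add: right_mult_one_mat[OF \<Gamma>i(1)] left_mult_one_mat[OF An(2)[OF nm(2)]]
        kronecker_mult[OF \<Gamma>i(1) one_carrier_mat one_carrier_mat An(2)[OF nm(2)]])
    have XB: "X * get_block e B n m \<in> carrier_mat (R * R) (R * R)" by (rule mult_carrier_mat[OF c(1) Bc])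
    have "P * X * get_block e B n m * (Y * Q) = P * (X * get_block e B n m * Y) * Q"
      by (simp only: assoc_mult_mat[OF c(3) c(1) Bc] assoc_mult_mat[OF c(3) XB c(2), symmetric]
        assoc_mult_mat[OF mult_carrier_mat[OF c(3) XB] c(2) c(4)])
    then show ?thesis
      unfolding PX YQ S_tilde_def B_block_def \<Gamma>i_def[symmetric] e_def[symmetric] B_def[symmetric]
        X_def[symmetric] Y_def[symmetric] P_def[symmetric] Q_def[symmetric] .
  qed
  have S_carrier: "?S n m \<in> carrier_mat (d n) (d m)" if nm: "n < N" "m < N" for n m
    unfolding S[OF nm, symmetric]
    using \<Gamma>i An nm
    by (auto simp: d get_block_def e intro!: mult_carrier_mat[of _ _ "R * R"])
  have "Gi * Z * B * (Zt * Gi) = rect_block_mat N d d ?S"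
  proof -
    have c: "\<Gamma>i n \<otimes>\<^sub>k A n \<in> carrier_mat (d n) (e n)" "\<Gamma>i n \<otimes>\<^sub>k (A n)\<^sup>T \<in> carrier_mat (e n) (d n)"
      if "n < N" for n
      using \<Gamma>i An[OF that] by (auto simp: d e)
    have Bc: "get_block e B n m \<in> carrier_mat (e n) (e m)" for n m by (simp add: get_block_def)
    have "Gi * Z * B = rect_block_mat N d e (\<lambda>n m. (\<Gamma>i n \<otimes>\<^sub>k A n) * get_block e B n m)"
      using block_diag_mult_rect[of N _ d e "get_block e B" e, OF c(1) Bc]
      unfolding GiZ rect_block_mat_get_block[OF B_carrier] .
    then have "Gi * Z * B * (Zt * Gi)
        = rect_block_mat N d d (\<lambda>n m. (\<Gamma>i n \<otimes>\<^sub>k A n) * get_block e B n m * (\<Gamma>i m \<otimes>\<^sub>k (A m)\<^sup>T))"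
      unfolding ZtGi by (simp add: rect_mult_block_diag c mult_carrier_mat[OF c(1) Bc])
    also have "\<dots> = rect_block_mat N d d ?S" by (rule rect_block_mat_cong) (rule S)
    finally show ?thesis .
  qed
  then have "mat_inv (H_mu N I R A \<mu>) = Gi - rect_block_mat N d d ?S"
    unfolding H inverse B[symmetric] by simp
  also have "\<dots> = H_tilde N I R A \<mu>"
  proof (rule eq_block_matI[where d = d and e = d and N = N])
    show "Gi - rect_block_mat N d d ?S \<in> carrier_mat (blk_off d N) (blk_off d N)"
      by (rule minus_carrier_mat) simp
    show "H_tilde N I R A \<mu> \<in> carrier_mat (blk_off d N) (blk_off d N)"
      unfolding H_tilde_def block_mat_eq_rect d_def by simp
    fix n m i j assume nm: "n < N" "m < N" and ij: "i < d n" "j < d m"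
    have ob: "blk_off d n + i < blk_off d N" "blk_off d m + j < blk_off d N"
      using nm ij by (auto intro: blk_off_less)
    \<comment> \<open>A difference of matrices takes its dimensions from the subtrahend, hence the
      carrier condition on \<open>Y\<close>.\<close>
    have minus: "(X - Y) $$ (i, j) = X $$ (i, j) - Y $$ (i, j)"
      if "Y \<in> carrier_mat (d n) (d m)" for X Y :: "real mat"
      using that ij by simp
    have "(Gi - rect_block_mat N d d ?S) $$ (blk_off d n + i, blk_off d m + j)
        = (if n = m then (\<Gamma>i n \<otimes>\<^sub>k 1\<^sub>m (I n)) $$ (i, j) else 0) - ?S n m $$ (i, j)"
      using nm ij ob carrier_matD[OF rect_block_mat_carrier[of N d d ?S]]
      by (simp add: Gi_def index_block_diag index_rect_block_mat)
    also have "\<dots> = H_tilde_block N I R A \<mu> n m $$ (i, j)"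
      unfolding H_tilde_block_def minus[OF S_carrier[OF nm]] \<Gamma>i_def[symmetric]
      using ij by (simp add: d)
    also have "\<dots> = H_tilde N I R A \<mu> $$ (blk_off d n + i, blk_off d m + j)"
      unfolding H_tilde_def block_mat_eq_rect d_def[symmetric] using nm ij
      by (simp add: index_rect_block_mat)
    finally show "(Gi - rect_block_mat N d d ?S) $$ (blk_off d n + i, blk_off d m + j)
        = H_tilde N I R A \<mu> $$ (blk_off d n + i, blk_off d m + j)" .
  qed
  finally have "mat_inv (H_mu N I R A \<mu>) = H_tilde N I R A \<mu>" .
  then show ?thesis
    using inv_\<Gamma> Kinv(1) inv_W inv_H unfolding W_def K_def[symmetric] H by simp
qed

end
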